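(* Let $(a_n)_{n\ge1}$ satisfy $a_n-\log n-(k-1)\log\log n\to\infty$ as $n\to\infty$, let $b_n=na_n^{k-1}e^{-a_n}$, and let $\alpha_k=e^{-s_0}/(k-1)!$. (i) If $a_n=o(n)$, then $b_n^{-1}\,\mathbb{P}(T_{k,n}\ge1)\to\alpha_k$ as $n\to\infty$. (ii) If $a_n=o(n^{1/3})$, then $b_n^{-1}\,\mathbb{P}(T^{\mathsf{B}}_{k,n}\ge1)\to\alpha_k$ as $n\to\infty$.
   Context: Fix integers $d\ge1$, $k\ge1$ and a real number $s_0$. The unit cube $[0,1]^d$ is equipped with the toroidal metric $\mathsf{dist}(x,y)=\min_{z\in\mathbb{Z}^d}\|x-y+z\|$ ($\|\cdot\|$ Euclidean); $B_r(x)=\{y\in[0,1]^d:\mathsf{dist}(x,y)\le r\}$. $\theta_d$ is the volume of the unit ball of $\mathbb{R}^d$. $\mathcal{P}_n$ is a homogeneous Poisson point process on $[0,1]^d$ with intensity $n$; $\mathcal{B}_n=\{X_1,\dots,X_n\}$ is a binomial point process, with $X_1,X_2,\dots$ i.i.d. uniform on $[0,1]^d$. For a point process $\omega$, $\omega(A)$ denotes the number of its points in $A$. Put $$r_n(s_0)=\Big(\frac{a_n+s_0}{n\theta_d}\Big)^{1/d}$$ (well defined for all large $n$), and $$T_{k,n}=\sum_{X\in\mathcal{P}_n}\mathbf{1}\{\mathcal{P}_n(B_{r_n(s_0)}(X))\le k\},\qquad T^{\mathsf{B}}_{k,n}=\sum_{X\in\mathcal{B}_n}\mathbf{1}\{\mathcal{B}_n(B_{r_n(s_0)}(X))\le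 k\}.$$ *)

theory Defs
  imports "HOL-Probability.Probability"
begin

definition unit_cube :: "(real ^ 'd) set" where
  "unit_cube = {x. \<forall>i. 0 \<le> x $ i \<and> x $ i \<le> 1}"

(* The infimum is attained, so it is the minimum over the integer lattice.
   On the closed cube this is only a pseudometric: opposite faces are identified. *)
definition torus_dist :: "real ^ 'd \<Rightarrow> real ^ 'd \<Rightarrow> real" where
  "torus_dist x y = (INF z\<in>{z. \<forall>i. z $ i \<in> \<int>}. norm (x - y + z))"

definition torus_ball :: "real \<Rightarrow> real ^ 'd \<Rightarrow> (real ^ 'd) set" where
  "torus_ball r x = {y \<in> unit_cube. torus_dist x y \<le> r}"

(* Realisations of a finite point process are finite multisets, so that points are
   counted with multiplicity. *)
definition num_points :: "'a multiset \<Rightarrow> 'a set \<Rightarrow> nat" where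
  "num_points \<omega> A = size (filter_mset (\<lambda>x. x \<in> A) \<omega>)"

(* The number of points X of the configuration whose closed r-ball contains at most k
   points of the configuration, X itself included. *)
definition low_degree_count :: "nat \<Rightarrow> real \<Rightarrow> (real ^ 'd) multiset \<Rightarrow> nat" where
  "low_degree_count k r \<omega> =
     size (filter_mset (\<lambda>x. num_points \<omega> (torus_ball r x) \<le> k) \<omega>)"

(* Homogeneous Poisson process of intensity t on the unit cube.  Null sets A are covered
   by the convention 0 ^ 0 = 1, which gives count 0 almost surely (poisson_pmf would not
   be adequate there).  The independence clause includes measurability of the counts. *)
definition poisson_process ::
    "'a measure \<Rightarrow> ('a \<Rightarrow> (real ^ 'd) multiset) \<Rightarrow> real \<Rightarrow> bool" where
  "poisson_process M N t \<longleftrightarrow>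
     prob_space M \<and>
     (\<forall>w\<in>space M. set_mset (N w) \<subseteq> unit_cube) \<and>
     (\<forall>A\<in>sets borel. A \<subseteq> unit_cube \<longrightarrow>
        (\<forall>j. measure M {w \<in> space M. num_points (N w) A = j} =
             (t * measure lborel A) ^ j / fact j * exp (- (t * measure lborel A)))) \<and>
     (\<forall>F. finite F \<and> F \<subseteq> sets borel \<and> \<Union>F \<subseteq> unit_cube \<and> disjoint F \<longrightarrow>
        prob_space.indep_vars M (\<lambda>_. count_space UNIV) (\<lambda>A w. num_points (N w) A) F)"

definition iid_uniform :: "'a measure \<Rightarrow> (nat \<Rightarrow> 'a \<Rightarrow> real ^ 'd) \<Rightarrow> bool" where
  "iid_uniform M X \<longleftrightarrow>
     prob_space M \<and>
     prob_space.indep_vars M (\<lambda>_. borel) X {1..} \<and>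
     (\<forall>i\<ge>1. distr M borel (X i) = uniform_measure lborel unit_cube)"

definition binomial_process :: "(nat \<Rightarrow> 'a \<Rightarrow> 'b) \<Rightarrow> nat \<Rightarrow> 'a \<Rightarrow> 'b multiset" where
  "binomial_process X n w = image_mset (\<lambda>i. X i w) (mset_set {1..n})"

end

theory Submission
  imports Defs "HOL-Real_Asymp.Real_Asymp"
begin

text \<open>
  Let \<open>x = a + s0\<close>, so that a ball of radius \<open>r\<close> on the torus has volume \<open>x / n\<close>, and let
  \<open>\<pi>\<^sub>m(y) = (\<Sum>i\<le>m. y\<^sup>i / i!) e\<^sup>-\<^sup>y\<close> be the distribution function of the Poisson law.  A point of the
  process has low degree if its ball contains at most \<open>k - 1\<close> further points, so the expected number
  of such points is \<open>n \<pi>\<^bsub>k-1\<^esub>(x)\<close>, up to a factor tending to \<open>1\<close> in the binomial case, and this is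
  asymptotic to \<open>\<alpha> b\<close>.  Since \<open>b \<longlonglongrightarrow> 0\<close>, such points are rare, and the probability
  that one exists agrees with the expected number as soon as pairs of them contribute \<open>o(b)\<close>.

  Pairs are classified by their distance \<open>h\<close>, for a small fixed \<open>\<epsilon> > 0\<close>.  If \<open>h \<le> \<epsilon> r\<close>, the ball around
  the first point already contains the second one and at most \<open>k - 2\<close> others; compared with a single
  point this saves one power of \<open>a\<close>, which pays for the \<open>\<epsilon>\<^sup>d x\<close> possible positions of the
  second point, and a contribution \<open>O(\<epsilon>\<^sup>d b)\<close> remains.  If \<open>\<epsilon> r < h \<le> 2 r\<close>, the second ball minus the
  first contains a ball of radius \<open>h / 3\<close>; that it holds few points has a probability exponentially small
  in \<open>x\<close>.  If \<open>h > 2 r\<close>, the two balls are disjoint and the contribution is \<open>O(b\<^sup>2)\<close>.  Let \<open>n\<close> tend to infinity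
  and then \<open>\<epsilon>\<close> to \<open>0\<close>.

  To obtain these estimates from the distribution of counts alone, the cube is cut into small cells.
  A point of the process at \<open>x\<close> is replaced by the event that the cell of \<open>x\<close> is occupied while a
  slightly smaller or larger ball around a fixed centre holds few points; the union bound and the
  Bonferroni inequality over cells then take the place of the first and second moment, and the mesh
  tends to \<open>0\<close> for fixed \<open>n\<close>.  This needs only three estimates on counts in disjoint sets, which are
  collected in the locale \<open>palm_estimates\<close>.  They hold for both processes
  (\<open>poisson_process_estimates\<close>, \<open>binomial_process_estimates\<close>); the geometric argument
  (\<open>low_degree_prob_upper\<close>, \<open>low_degree_prob_lower\<close>) and the passage to the limit
  (\<open>palm_estimates_limit\<close>) are common to both.
\<close>

section \<open>Geometry of the torus\<close>

definition integer_lattice :: "(real ^ 'd) set" where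
  "integer_lattice = {z. \<forall>i. z $ i \<in> \<int>}"

lemma zero_in_lattice: "0 \<in> integer_lattice"
  by (simp add: integer_lattice_def)

lemma lattice_add: "z \<in> integer_lattice \<Longrightarrow> z' \<in> integer_lattice \<Longrightarrow> z + z' \<in> integer_lattice"
  by (simp add: integer_lattice_def)

lemma lattice_diff: "z \<in> integer_lattice \<Longrightarrow> z' \<in> integer_lattice \<Longrightarrow> z - z' \<in> integer_lattice"
  by (simp add: integer_lattice_def)

lemma lattice_uminus: "z \<in> integer_lattice \<Longrightarrow> - z \<in> integer_lattice"
  by (simp add: integer_lattice_def)

lemma closed_integer_lattice: "closed (integer_lattice :: (real ^ 'd) set)"
proof -
  have eq: "integer_lattice = (\<Inter>i. (\<lambda>z :: real ^ 'd. z $ i) -` \<int>)"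
    by (auto simp: integer_lattice_def)
  show ?thesis
    unfolding eq by (intro closed_INT ballI closed_vimage closed_Ints continuous_intros)
qed

lemma countable_integer_lattice: "countable (integer_lattice :: (real ^ 'd) set)"
  using countable_vector[of "\<lambda>_. \<int>"] by (simp add: integer_lattice_def countable_int)

lemma lattice_norm_ge_1:
  assumes "z \<in> integer_lattice" "z \<noteq> 0"
  shows "1 \<le> norm z"
proof -
  obtain i where i: "z $ i \<noteq> 0"
    using assms(2) by (auto simp: vec_eq_iff)
  have "z $ i \<in> \<int>"
    using assms(1) by (simp add: integer_lattice_def)
  then have "1 \<le> \<bar>z $ i\<bar>"
    using i Ints_nonzero_abs_ge1 by blast
  also have "\<dots> \<le> norm z"
    by (rule component_le_norm_cart)
  finally show ?thesis .
qed

lemma torus_dist_lattice: "torus_dist x y = (INF z\<in>integer_lattice. norm (x - y + z))"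
  by (simp add: torus_dist_def integer_lattice_def)

lemma torus_dist_le: "z \<in> integer_lattice \<Longrightarrow> torus_dist x y \<le> norm (x - y + z)"
  unfolding torus_dist_lattice by (rule cINF_lower) (auto intro: bdd_belowI[of _ 0])

lemma torus_dist_attained: "\<exists>z\<in>integer_lattice. torus_dist x y = norm (x - y + z)"
proof -
  obtain z where z: "z \<in> integer_lattice" "\<And>z'. z' \<in> integer_lattice \<Longrightarrow> dist (y - x) z \<le> dist (y - x) z'"
    using distance_attains_inf[OF closed_integer_lattice, of "y - x"] zero_in_lattice by blast
  have "torus_dist x y = norm (x - y + z)"
  proof (rule antisym)
    show "torus_dist x y \<le> norm (x - y + z)"
      by (rule torus_dist_le[OF z(1)])
    show "norm (x - y + z) \<le> torus_dist x y"
      unfolding torus_dist_lattice using z zero_in_lattice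
      by (intro cINF_greatest) (auto simp: dist_norm norm_minus_commute algebra_simps)
  qed
  then show ?thesis
    using z(1) by blast
qed

lemma torus_dist_nonneg: "0 \<le> torus_dist x y"
  using torus_dist_attained[of x y] by auto

lemma torus_dist_le_norm: "torus_dist x y \<le> norm (x - y)"
  using torus_dist_le[OF zero_in_lattice, of x y] by simp

lemma torus_dist_self [simp]: "torus_dist x x = 0"
  using torus_dist_le_norm[of x x] torus_dist_nonneg[of x x] by simp

lemma torus_dist_commute: "torus_dist x y = torus_dist y x"
proof -
  have "torus_dist x y \<le> torus_dist y x" for x y :: "real ^ 'd"
  proof -
    obtain z where z: "z \<in> integer_lattice" "torus_dist y x = norm (y - x + z)"
      using torus_dist_attained by blast
    have "torus_dist x y \<le> norm (x - y + - z)"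
      using z(1) by (intro torus_dist_le lattice_uminus)
    also have "\<dots> = torus_dist y x"
      unfolding z(2) by (metis add_uminus_conv_diff minus_add_distrib minus_diff_eq norm_minus_cancel)
    finally show ?thesis .
  qed
  then show ?thesis
    by (intro antisym)
qed

lemma torus_dist_triangle: "torus_dist x y \<le> torus_dist x u + torus_dist u y"
proof -
  obtain z where z: "z \<in> integer_lattice" "torus_dist x u = norm (x - u + z)"
    using torus_dist_attained by blast
  obtain z' where z': "z' \<in> integer_lattice" "torus_dist u y = norm (u - y + z')"
    using torus_dist_attained by blast
  have "torus_dist x y \<le> norm (x - y + (z + z'))"
    using z z' by (intro torus_dist_le lattice_add)
  also have "\<dots> = norm ((x - u + z) + (u - y + z'))"
    by (simp add: algebra_simps)
  also have "\<dots> \<le> torus_dist x u + torus_dist u y"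
    unfolding z(2) z'(2) by (rule norm_triangle_ineq)
  finally show ?thesis .
qed

text \<open>A nonzero lattice vector has length at least \<open>1\<close>, so no translation brings two points at distance
  at most \<open>1/2\<close> closer together.\<close>

lemma torus_dist_eq_norm:
  assumes "norm (x - y) \<le> 1/2"
  shows "torus_dist x y = norm (x - y)"
proof (rule antisym[OF torus_dist_le_norm])
  show "norm (x - y) \<le> torus_dist x y"
  proof -
    obtain z where z: "z \<in> integer_lattice" "torus_dist x y = norm (x - y + z)"
      using torus_dist_attained by blast
    show ?thesis
    proof (cases "z = 0")
      case False
      have "1 \<le> norm z"
        using lattice_norm_ge_1 z(1) False by blast
      also have "norm z \<le> norm (x - y + z) + norm (x - y)"
        by (metis add_diff_cancel_left' norm_triangle_ineq4)
      finally show ?thesis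
        using assms z(2) by simp
    qed (use z in simp)
  qed
qed

lemma torus_dist_add_lattice:
  fixes x y z :: "real ^ 'd"
  assumes "z \<in> integer_lattice"
  shows "torus_dist (x + z) y = torus_dist x y"
proof -
  have *: "torus_dist (x + z) y \<le> torus_dist x y" if z: "z \<in> integer_lattice" for x z
    using torus_dist_triangle[of "x + z" y x] torus_dist_le[OF lattice_uminus[OF z], of "x + z" x]
    by simp
  show ?thesis
    using *[OF assms, of x] *[OF lattice_uminus[OF assms], of "x + z"] by simp
qed

lemma continuous_on_torus_dist: "continuous_on S (torus_dist x)"
proof (rule continuous_onI)
  fix y and e :: real assume "y \<in> S" "0 < e"
  have "dist (torus_dist x y') (torus_dist x y) \<le> dist y' y" for y'
    using torus_dist_triangle[of x y y'] torus_dist_triangle[of x y' y]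
      torus_dist_le_norm[of y y'] torus_dist_le_norm[of y' y]
    by (auto simp: dist_real_def dist_norm norm_minus_commute abs_le_iff)
  then show "\<exists>d>0. \<forall>y'\<in>S. dist y' y < d \<longrightarrow> dist (torus_dist x y') (torus_dist x y) \<le> e"
    using \<open>0 < e\<close> by (intro exI[of _ e]) (meson less_eq_real_def order_trans)
qed

lemma unit_cube_cbox: "unit_cube = cbox 0 (1 :: real ^ 'd)"
  by (auto simp: unit_cube_def mem_box_cart)

lemma compact_unit_cube: "compact (unit_cube :: (real ^ 'd) set)"
  by (simp add: unit_cube_cbox)

lemma unit_cube_borel [measurable]: "unit_cube \<in> sets borel"
  by (simp add: unit_cube_cbox)

lemma emeasure_unit_cube: "emeasure lborel (unit_cube :: (real ^ 'd) set) = 1"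
proof -
  have "(\<Prod>b\<in>Basis. (1 - 0 :: real ^ 'd) \<bullet> b) = 1"
    by (intro prod.neutral) (auto simp: Basis_vec_def inner_axis)
  moreover have "\<forall>b\<in>Basis. (0 :: real ^ 'd) \<bullet> b \<le> 1 \<bullet> b"
    by (auto simp: Basis_vec_def inner_axis)
  ultimately show ?thesis
    unfolding unit_cube_cbox emeasure_lborel_cbox_eq by simp
qed

lemma measure_unit_cube: "measure lborel (unit_cube :: (real ^ 'd) set) = 1"
  by (simp add: measure_def emeasure_unit_cube)

lemma torus_ball_subset_cube: "torus_ball r x \<subseteq> unit_cube"
  by (auto simp: torus_ball_def)

lemma torus_ball_borel [measurable]: "torus_ball r x \<in> sets borel"
proof -
  have "closed {y. torus_dist x y \<le> r}"
    by (intro closed_Collect_le continuous_on_torus_dist continuous_on_const)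
  moreover have "torus_ball r x = unit_cube \<inter> {y. torus_dist x y \<le> r}"
    by (auto simp: torus_ball_def)
  ultimately show ?thesis
    by simp
qed

text \<open>The translates of the half-open unit cube \<open>C\<close> tile the space.  They cut the Euclidean ball into
  pieces \<open>S z\<close>; moved back into \<open>C\<close>, these become the pieces \<open>T z\<close> of the torus ball, which do not
  overlap because \<open>r < 1/2\<close>.\<close>

lemma emeasure_torus_ball:
  fixes x :: "real ^ 'd"
  assumes "0 \<le> r" "r < 1/2"
  shows "emeasure lborel (torus_ball r x) = ennreal (unit_ball_vol (real CARD('d)) * r ^ CARD('d))"
proof -
  define C where "C = {y :: real ^ 'd. \<forall>i. 0 \<le> y $ i \<and> y $ i < 1}"
  define S where "S z = {y. y + z \<in> C} \<inter> cball x r" for z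
  have C[measurable]: "C \<in> sets borel"
    unfolding C_def by measurable
  have S[measurable]: "S z \<in> sets borel" for z
    unfolding S_def by measurable
  have cover: "(\<Union>z\<in>integer_lattice. S z) = cball x r"
  proof -
    have "\<exists>z\<in>integer_lattice. y + z \<in> C" for y :: "real ^ 'd"
    proof
      show "y + (\<chi> i. - of_int \<lfloor>y $ i\<rfloor>) \<in> C"
        by (auto simp: C_def) linarith
    qed (auto simp: integer_lattice_def)
    then show ?thesis
      by (auto simp: S_def)
  qed
  have disjS: "disjoint_family_on S integer_lattice"
  proof -
    have "z = z'" if "z \<in> integer_lattice" "z' \<in> integer_lattice" "y + z \<in> C" "y + z' \<in> C" for y z z'
    proof (rule vec_eq_iff[THEN iffD2], rule allI)
      fix i
      have "\<bar>z $ i - z' $ i\<bar> < 1"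
        using that(3)[unfolded C_def mem_Collect_eq, THEN spec, of i]
          that(4)[unfolded C_def mem_Collect_eq, THEN spec, of i] by auto
      moreover have "z $ i \<in> \<int>" "z' $ i \<in> \<int>"
        using that(1,2) by (auto simp: integer_lattice_def)
      ultimately show "z $ i = z' $ i"
        by (meson Ints_eq_abs_less1)
    qed
    then show ?thesis
      unfolding disjoint_family_on_def S_def by blast
  qed
  define T where "T z = C \<inter> cball (x + z) r" for z
  have T[measurable]: "T z \<in> sets borel" for z
    unfolding T_def by measurable
  have ST: "emeasure lborel (S z) = emeasure lborel (T z)" for z
  proof -
    have "emeasure lborel (T z) = emeasure (distr lborel borel ((+) z)) (T z)"
      by (simp add: lborel_distr_plus)
    also have "\<dots> = emeasure lborel ((+) z -` T z \<inter> space lborel)"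
      by (rule emeasure_distr) auto
    also have "(+) z -` T z \<inter> space lborel = S z"
      by (auto simp: S_def T_def dist_norm algebra_simps)
    finally show ?thesis by simp
  qed
  have disjT: "disjoint_family_on T integer_lattice"
  proof -
    have "z = z'" if "z \<in> integer_lattice" "z' \<in> integer_lattice"
      "dist (x + z) y \<le> r" "dist (x + z') y \<le> r" for y z z'
    proof (rule ccontr)
      assume "z \<noteq> z'"
      then have "1 \<le> norm (z - z')"
        using that by (intro lattice_norm_ge_1 lattice_diff) auto
      also have "norm (z - z') = dist (x + z) (x + z')"
        by (simp add: dist_norm)
      also have "\<dots> \<le> dist (x + z) y + dist (x + z') y"
        by (metis dist_commute dist_triangle)
      also have "\<dots> < 1"
        using that(3,4) assms(2) by linarith
      finally show False by simp
    qed
    then show ?thesis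
      unfolding disjoint_family_on_def T_def by fastforce
  qed
  have Tball: "(\<Union>z\<in>integer_lattice. T z) = torus_ball r x \<inter> C"
  proof (intro equalityI subsetI)
    fix y assume "y \<in> (\<Union>z\<in>integer_lattice. T z)"
    then obtain z where z: "z \<in> integer_lattice" "y \<in> C" "dist (x + z) y \<le> r"
      by (auto simp: T_def)
    have "torus_dist x y \<le> norm (x - y + z)"
      by (rule torus_dist_le[OF z(1)])
    also have "\<dots> \<le> r"
      using z(3) by (simp add: dist_norm algebra_simps)
    finally show "y \<in> torus_ball r x \<inter> C"
      using z(2) by (auto simp: torus_ball_def C_def unit_cube_def less_imp_le)
  next
    fix y assume y: "y \<in> torus_ball r x \<inter> C"
    obtain z where z: "z \<in> integer_lattice" "torus_dist x y = norm (x - y + z)"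
      using torus_dist_attained by blast
    then show "y \<in> (\<Union>z\<in>integer_lattice. T z)"
      using y by (auto simp: T_def torus_ball_def dist_norm algebra_simps intro!: bexI[of _ z])
  qed
  have null: "emeasure lborel (torus_ball r x - C) = 0"
  proof -
    have "emeasure lborel (torus_ball r x - C) \<le> emeasure lborel (cbox 0 1 - box 0 (1 :: real ^ 'd))"
    proof (rule emeasure_mono)
      show "torus_ball r x - C \<subseteq> cbox 0 1 - box 0 1"
        unfolding torus_ball_def unit_cube_cbox C_def
        by (auto simp: mem_box_cart intro: less_imp_le)
    qed simp
    also have "\<dots> = 0"
      by (subst emeasure_Diff) (auto simp: emeasure_lborel_box_eq emeasure_lborel_cbox_eq box_subset_cbox)
    finally show ?thesis by simp
  qed
  have "emeasure lborel (torus_ball r x) = emeasure lborel (torus_ball r x \<inter> C)"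
    by (rule emeasure_eq_AE) 
      (use null in \<open>auto intro!: AE_I[where N="torus_ball r x - C"]\<close>)
  also have "\<dots> = (\<integral>\<^sup>+z. emeasure lborel (T z) \<partial>count_space integer_lattice)"
    unfolding Tball[symmetric]
    by (rule emeasure_UN_countable) (auto simp: countable_integer_lattice disjT)
  also have "\<dots> = emeasure lborel (cball x r)"
    unfolding ST[symmetric] cover[symmetric]
    by (rule emeasure_UN_countable[symmetric]) (auto simp: countable_integer_lattice disjS)
  also have "\<dots> = ennreal (unit_ball_vol (real CARD('d)) * r ^ CARD('d))"
    using emeasure_cball[OF assms(1), of x] by simp
  finally show ?thesis .
qed

lemma torus_ball_mono:
  assumes "torus_dist x y + r \<le> s"
  shows "torus_ball r x \<subseteq> torus_ball s y"
proof -
  have "torus_dist y u \<le> s" if "torus_dist x u \<le> r" for u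
    using assms that torus_dist_triangle[of y u x] torus_dist_commute[of x y] by linarith
  then show ?thesis
    by (auto simp: torus_ball_def)
qed

lemma torus_ball_disjoint:
  assumes "r + s < torus_dist x y"
  shows "torus_ball r x \<inter> torus_ball s y = {}"
proof -
  have False if "torus_dist x u \<le> r" "torus_dist y u \<le> s" for u
    using assms that torus_dist_triangle[of x y u] torus_dist_commute[of y u] by linarith
  then show ?thesis
    by (auto simp: torus_ball_def)
qed

text \<open>Walk from \<open>y\<close> a distance \<open>r - h/3\<close> straight away from the nearest copy of \<open>x\<close>, where \<open>h\<close> is the
  distance of \<open>x\<close> and \<open>y\<close>.  The point \<open>c\<close> reached lies at distance \<open>r + 2h/3\<close> from \<open>x\<close>; this is still a
  torus distance since \<open>h \<le> 2r\<close> and \<open>r < 3/14\<close> give \<open>r + 2h/3 < 1/2\<close>.\<close>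

lemma torus_ball_difference_contains_ball:
  fixes x y :: "real ^ 'd"
  assumes h: "0 < torus_dist x y" "torus_dist x y \<le> 2 * r" and r: "r < 3/14"
  shows "\<exists>c. torus_ball (torus_dist x y / 3) c \<subseteq> torus_ball r y
           \<and> torus_ball (torus_dist x y / 3) c \<inter> torus_ball r x = {}"
proof -
  define h where "h = torus_dist x y"
  obtain z where z: "z \<in> integer_lattice" "h = norm (x - y + z)"
    using torus_dist_attained h_def by blast
  define e where "e = (1 / h) *\<^sub>R (y - (x + z))"
  define c where "c = y + (r - h/3) *\<^sub>R e"
  have hpos: "0 < h" "h \<le> 2 * r"
    using assms by (auto simp: h_def)
  have norm_e: "norm e = 1"
  proof -
    have "h = norm (y - (x + z))"
      unfolding z(2) by (metis add_diff_eq diff_add_eq norm_minus_commute)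
    then show ?thesis
      using hpos(1) unfolding e_def norm_scaleR by simp
  qed
  have yx: "y = x + z + h *\<^sub>R e"
    using hpos(1) by (simp add: e_def)
  have "torus_dist c y \<le> norm (c - y)"
    by (rule torus_dist_le_norm)
  also have "\<dots> = r - h/3"
    using hpos by (simp add: c_def norm_e)
  finally have cy: "torus_dist c y \<le> r - h/3" .
  have "c - (x + z) = (r + 2 * h / 3) *\<^sub>R e"
  proof -
    have "c - (x + z) = (y - (x + z)) + (r - h/3) *\<^sub>R e"
      by (simp add: c_def)
    also have "y - (x + z) = h *\<^sub>R e"
      using yx by simp
    also have "h *\<^sub>R e + (r - h/3) *\<^sub>R e = (h + (r - h/3)) *\<^sub>R e"
      by (rule scaleR_left_distrib[symmetric])
    also have "h + (r - h/3) = r + 2 * h / 3"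
      by simp
    finally show ?thesis .
  qed
  then have n: "norm (c - (x + z)) = r + 2 * h / 3"
    using hpos by (simp add: norm_e)
  then have "torus_dist c (x + z) = r + 2 * h / 3"
    using hpos r by (subst torus_dist_eq_norm) auto
  then have cx: "torus_dist c x = r + 2 * h / 3"
    using torus_dist_add_lattice[OF z(1), of x c] by (simp add: torus_dist_commute)
  have "torus_ball (h/3) c \<subseteq> torus_ball r y"
    using cy by (intro torus_ball_mono) simp
  moreover have "torus_ball (h/3) c \<inter> torus_ball r x = {}"
    using cx hpos(1) by (intro torus_ball_disjoint) simp
  ultimately show ?thesis
    unfolding h_def by blast
qed

lemma cube_partition:
  fixes \<delta> :: real
  assumes "0 < \<delta>"
  shows "\<exists>p (Q :: nat \<Rightarrow> (real ^ 'd) set) q. disjoint_family Q \<and> (\<forall>i. Q i \<in> sets borel)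
           \<and> (\<Union>i<p. Q i) = unit_cube \<and> (\<forall>i. Q i \<subseteq> torus_ball \<delta> (q i))"
proof -
  have "\<exists>C. finite C \<and> unit_cube \<subseteq> (\<Union>c\<in>C. ball (c :: real ^ 'd) \<delta>)"
    using compact_unit_cube assms unfolding compact_eq_totally_bounded by blast
  then obtain C where C: "finite C" "unit_cube \<subseteq> (\<Union>c\<in>C. ball (c :: real ^ 'd) \<delta>)"
    by blast
  obtain q :: "nat \<Rightarrow> real ^ 'd" and p where q: "C = q ` {i. i < p}"
    using finite_imp_nat_seg_image_inj_on[OF C(1)] by blast
  define A where "A i = unit_cube \<inter> ball (q i) \<delta>" for i
  have A: "A i \<in> sets borel" for i
    unfolding A_def by measurable
  have "disjointed A i \<in> sets borel" for i
    using A sets.range_disjointed_sets[of A borel] by auto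
  moreover have "(\<Union>i<p. disjointed A i) = unit_cube"
    using finite_UN_disjointed_eq[of A p] C(2) q by (auto simp: A_def atLeast0LessThan)
  moreover have "disjointed A i \<subseteq> torus_ball \<delta> (q i)" for i
  proof -
    have "A i \<subseteq> torus_ball \<delta> (q i)"
      using order_trans[OF torus_dist_le_norm[of "q i"]] by (auto simp: A_def torus_ball_def dist_norm)
    then show ?thesis
      using disjointed_subset[of A i] by blast
  qed
  ultimately show ?thesis
    using disjoint_family_disjointed[of A] by blast
qed

section \<open>Volumes, the Poisson distribution function and counts\<close>

definition ball_vol :: "nat \<Rightarrow> real \<Rightarrow> real" where
  "ball_vol d r = unit_ball_vol (real d) * r ^ d"

lemma vol_torus_ball:
  "0 \<le> r \<Longrightarrow> r < 1/2 \<Longrightarrow> measure lborel (torus_ball r (x :: real ^ 'd)) = ball_vol CARD('d) r"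
  using emeasure_torus_ball[of r x] by (simp add: measure_def ball_vol_def)

lemma ball_vol_nonneg: "0 \<le> r \<Longrightarrow> 0 \<le> ball_vol d r"
  by (simp add: ball_vol_def)

lemma ball_vol_mono: "0 \<le> r \<Longrightarrow> r \<le> s \<Longrightarrow> ball_vol d r \<le> ball_vol d s"
  by (simp add: ball_vol_def mult_left_mono power_mono)

lemma ball_vol_0: "0 < d \<Longrightarrow> ball_vol d 0 = 0"
  by (simp add: ball_vol_def)

lemma tendsto_ball_vol [tendsto_intros]:
  "(f \<longlongrightarrow> c) G \<Longrightarrow> ((\<lambda>x. ball_vol d (f x)) \<longlongrightarrow> ball_vol d c) G"
  unfolding ball_vol_def by (intro tendsto_intros)

text \<open>Lengthening the radius by \<open>2\<delta>\<close> makes up for the removal of two cells that lie in balls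
  of radius \<open>\<delta>\<close>.\<close>

lemma ball_vol_enlarge:
  assumes "0 < d" "0 \<le> r" "0 \<le> \<delta>"
  shows "ball_vol d r + 2 * ball_vol d \<delta> \<le> ball_vol d (r + 2 * \<delta>)"
proof -
  have add: "x ^ n + y ^ n \<le> (x + y) ^ n" if "0 < n" "0 \<le> x" "0 \<le> y" for x y :: real and n
    using that(1)
  proof (induction n rule: nat_induct_non_zero)
    case (Suc n)
    have "x ^ Suc n + y ^ Suc n \<le> (x + y) * (x ^ n + y ^ n)"
      using that by (simp add: algebra_simps)
    also have "\<dots> \<le> (x + y) * (x + y) ^ n"
      using Suc.IH that by (intro mult_left_mono) auto
    finally show ?case by simp
  qed simp
  have "r ^ d + 2 * \<delta> ^ d \<le> r ^ d + \<delta> ^ d + \<delta> ^ d"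
    by simp
  also have "\<dots> \<le> (r + \<delta>) ^ d + \<delta> ^ d"
    using add[OF assms] by simp
  also have "\<dots> \<le> (r + \<delta> + \<delta>) ^ d"
    using assms by (intro add) auto
  finally have "unit_ball_vol (real d) * (r ^ d + 2 * \<delta> ^ d) \<le> unit_ball_vol (real d) * (r + 2 * \<delta>) ^ d"
    by (intro mult_left_mono) (auto simp: algebra_simps)
  then show ?thesis
    by (simp add: ball_vol_def algebra_simps)
qed

definition poisson_cdf :: "nat \<Rightarrow> real \<Rightarrow> real" where
  "poisson_cdf m x = (\<Sum>i\<le>m. x ^ i / fact i) * exp (- x)"

lemma poisson_cdf_nonneg: "0 \<le> x \<Longrightarrow> 0 \<le> poisson_cdf m x"
  by (auto simp: poisson_cdf_def intro!: mult_nonneg_nonneg sum_nonneg)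

lemma poisson_cdf_0 [simp]: "poisson_cdf m 0 = 1"
proof -
  have "(\<Sum>i\<le>m. (0 :: real) ^ i / fact i) = (\<Sum>i\<in>{0}. 0 ^ i / fact i)"
    by (rule sum.mono_neutral_right) auto
  also have "\<dots> = 1"
    by simp
  finally show ?thesis
    unfolding poisson_cdf_def minus_zero exp_zero mult_1_right .
qed

text \<open>Differentiating term by term gives a telescoping sum.\<close>

lemma poisson_cdf_has_derivative:
  "(poisson_cdf m has_real_derivative - (x ^ m / fact m * exp (- x))) (at x)"
proof (induction m)
  case 0
  have "poisson_cdf 0 = (\<lambda>x. exp (- x))"
    by (simp add: poisson_cdf_def fun_eq_iff)
  then show ?case
    by (auto intro!: derivative_eq_intros)
next
  case (Suc m)
  have eq: "poisson_cdf (Suc m) = (\<lambda>x. poisson_cdf m x + x ^ Suc m / fact (Suc m) * exp (- x))"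
    by (simp add: poisson_cdf_def fun_eq_iff algebra_simps)
  have "real (Suc m) * x ^ m / fact (Suc m) = x ^ m / fact m"
  proof -
    have "real (Suc m) * x ^ m / fact (Suc m) = (real (Suc m) * x ^ m) / (real (Suc m) * fact m)"
      by simp
    then show ?thesis
      by (simp only: mult_divide_mult_cancel_left_if) simp
  qed
  then have 1: "((\<lambda>x. x ^ Suc m / fact (Suc m)) has_real_derivative x ^ m / fact m) (at x)"
    using DERIV_cdivide[OF DERIV_pow[of "Suc m" x UNIV], of "fact (Suc m)"] by simp
  have 2: "((\<lambda>x. exp (- x)) has_real_derivative - exp (- x)) (at x)"
    by (auto intro!: derivative_eq_intros)
  note DERIV_mult[OF 1 2]
  from DERIV_add[OF Suc.IH this] show ?case
    unfolding eq by (simp add: algebra_simps)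
qed

lemma isCont_poisson_cdf: "isCont (poisson_cdf m) x"
  using poisson_cdf_has_derivative by (rule DERIV_isCont)

lemma tendsto_poisson_cdf [tendsto_intros]:
  "(f \<longlongrightarrow> c) G \<Longrightarrow> ((\<lambda>x. poisson_cdf m (f x)) \<longlongrightarrow> poisson_cdf m c) G"
  by (rule isCont_tendsto_compose[OF isCont_poisson_cdf])

lemma poisson_cdf_antimono:
  assumes "0 \<le> x" "x \<le> y"
  shows "poisson_cdf m y \<le> poisson_cdf m x"
  using assms(2)
proof (rule DERIV_nonpos_imp_nonincreasing)
  fix u assume "x \<le> u" "u \<le> y"
  then show "\<exists>D. (poisson_cdf m has_real_derivative D) (at u) \<and> D \<le> 0"
    using assms(1) by (intro exI[of _ "- (u ^ m / fact m * exp (- u))"] conjI poisson_cdf_has_derivative) auto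
qed

lemma poisson_cdf_le_1: "0 \<le> x \<Longrightarrow> poisson_cdf m x \<le> 1"
  using poisson_cdf_antimono[of 0 x m] by simp

lemma num_points_ge_1_iff: "1 \<le> num_points \<omega> A \<longleftrightarrow> (\<exists>x\<in>#\<omega>. x \<in> A)"
  by (induction \<omega>) (auto simp: num_points_def)

lemma num_points_mono: "A \<subseteq> B \<Longrightarrow> num_points \<omega> A \<le> num_points \<omega> B"
  unfolding num_points_def by (intro size_mset_mono) (auto intro!: filter_mset_mono_strong)

lemma num_points_Un_disjoint:
  "A \<inter> B = {} \<Longrightarrow> num_points \<omega> (A \<union> B) = num_points \<omega> A + num_points \<omega> B"
  unfolding num_points_def by (induction \<omega>) auto

lemma num_points_empty [simp]: "num_points \<omega> {} = 0"
  by (simp add: num_points_def)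

lemma num_points_remove:
  assumes "1 \<le> num_points \<omega> Q" "Q \<subseteq> A"
  shows "num_points \<omega> (A - Q) + 1 \<le> num_points \<omega> A"
  using num_points_Un_disjoint[of Q "A - Q" \<omega>] assms
  by (simp add: Un_absorb1 Un_Diff_cancel)

lemma low_degree_count_ge_1_iff:
  "1 \<le> low_degree_count k r \<omega> \<longleftrightarrow> (\<exists>x\<in>#\<omega>. num_points \<omega> (torus_ball r x) \<le> k)"
  using num_points_ge_1_iff[of \<omega> "{x. num_points \<omega> (torus_ball r x) \<le> k}"]
  by (simp add: low_degree_count_def num_points_def)

lemma fmeasurable_in_cube:
  assumes "A \<in> sets borel" "A \<subseteq> unit_cube"
  shows "A \<in> fmeasurable (lborel :: (real ^ 'd) measure)"
proof (rule fmeasurableI2[of unit_cube])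
  show "unit_cube \<in> fmeasurable (lborel :: (real ^ 'd) measure)"
    by (simp add: fmeasurable_def emeasure_unit_cube)
qed (use assms in auto)

lemma vol_mono_in_cube:
  fixes A B :: "(real ^ 'd) set"
  assumes "A \<subseteq> B" "A \<in> sets borel" "B \<in> sets borel" "B \<subseteq> unit_cube"
  shows "measure lborel A \<le> measure lborel B"
  using assms by (intro measure_mono_fmeasurable) (auto intro: fmeasurable_in_cube)

lemma vol_le_1:
  fixes A :: "(real ^ 'd) set"
  assumes "A \<in> sets borel" "A \<subseteq> unit_cube"
  shows "measure lborel A \<le> 1"
  using vol_mono_in_cube[of A unit_cube] assms by (simp add: measure_unit_cube)

lemma vol_Diff_ge:
  fixes A B :: "(real ^ 'd) set"
  assumes "A \<in> sets borel" "A \<subseteq> unit_cube" "B \<in> sets borel" "B \<subseteq> unit_cube"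
  shows "measure lborel A - measure lborel B \<le> measure lborel (A - B)"
proof -
  have "measure lborel A \<le> measure lborel ((A - B) \<union> B)"
    using assms by (intro vol_mono_in_cube) auto
  also have "\<dots> \<le> measure lborel (A - B) + measure lborel B"
    using assms by (intro measure_Un_le) auto
  finally show ?thesis by simp
qed

lemma vol_UN_disjoint:
  fixes Q :: "nat \<Rightarrow> (real ^ 'd) set"
  assumes "finite I" "disjoint_family_on Q I" "\<And>i. i \<in> I \<Longrightarrow> Q i \<in> sets borel" "\<And>i. i \<in> I \<Longrightarrow> Q i \<subseteq> unit_cube"
  shows "measure lborel (\<Union>i\<in>I. Q i) = (\<Sum>i\<in>I. measure lborel (Q i))"
proof (rule measure_finite_Union)
  show "emeasure lborel (Q i) \<noteq> \<infinity>" if "i \<in> I" for i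
    using fmeasurableD2[OF fmeasurable_in_cube[OF assms(3)[OF that] assms(4)[OF that]]] by simp
qed (use assms in auto)

text \<open>Every unordered pair is subtracted twice.  This weaker form suffices because the pair terms only
  have to be negligible.\<close>

lemma (in prob_space) bonferroni_lower:
  assumes "finite I" "\<And>i. i \<in> I \<Longrightarrow> A i \<in> events"
  shows "(\<Sum>i\<in>I. prob (A i)) - (\<Sum>i\<in>I. \<Sum>j\<in>I - {i}. prob (A i \<inter> A j)) \<le> prob (\<Union>i\<in>I. A i)"
  using assms
proof (induction I)
  case (insert x I)
  let ?U = "\<Union>i\<in>I. A i"
  have ev: "A x \<in> events" "?U \<in> events"
    using insert by auto
  have "prob (A x \<inter> ?U) = prob (\<Union>j\<in>I. A x \<inter> A j)"
    by (rule arg_cong[where f = prob]) auto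
  also have "\<dots> \<le> (\<Sum>j\<in>I. prob (A x \<inter> A j))"
    using insert by (intro finite_measure_subadditive_finite) auto
  finally have 1: "prob (A x \<inter> ?U) \<le> (\<Sum>j\<in>I. prob (A x \<inter> A j))" .
  have 2: "prob (A x \<union> ?U) = prob (A x) + prob ?U - prob (A x \<inter> ?U)"
    using measure_Un3[of "A x" M ?U] ev by (simp add: fmeasurable_eq_sets)
  have 3: "(\<Sum>i\<in>I. \<Sum>j\<in>I - {i}. prob (A i \<inter> A j)) \<le> (\<Sum>i\<in>I. \<Sum>j\<in>insert x I - {i}. prob (A i \<inter> A j))"
    using insert.hyps by (intro sum_mono sum_mono2) auto
  have 4: "insert x I - {x} = I"
    using insert.hyps by auto
  have IH: "(\<Sum>i\<in>I. prob (A i)) - (\<Sum>i\<in>I. \<Sum>j\<in>I - {i}. prob (A i \<inter> A j)) \<le> prob ?U"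
    using insert by auto
  show ?case
    using 1 2 3 IH insert.hyps by (simp add: 4)
qed simp

lemma fine_cube_partition:
  fixes \<delta> :: real
  assumes "0 < \<delta>" "\<delta> < 1/2"
  obtains p and Q :: "nat \<Rightarrow> (real ^ 'd) set" and q where
    "disjoint_family Q" "\<And>i. Q i \<in> sets borel" "(\<Union>i<p. Q i) = unit_cube"
    "\<And>i. Q i \<subseteq> torus_ball \<delta> (q i)" "\<And>i. measure lborel (Q i) \<le> ball_vol CARD('d) \<delta>"
    "(\<Sum>i<p. measure lborel (Q i)) = 1"
proof -
  obtain p and Q :: "nat \<Rightarrow> (real ^ 'd) set" and q where *:
    "disjoint_family Q" "\<And>i. Q i \<in> sets borel" "(\<Union>i<p. Q i) = unit_cube"
    "\<And>i. Q i \<subseteq> torus_ball \<delta> (q i)"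
    using cube_partition[OF assms(1), where 'd = 'd] by blast
  have cube: "Q i \<subseteq> unit_cube" for i
    using *(4) torus_ball_subset_cube by blast
  have "measure lborel (Q i) \<le> measure lborel (torus_ball \<delta> (q i))" for i
    using * by (intro vol_mono_in_cube torus_ball_subset_cube) auto
  then have "measure lborel (Q i) \<le> ball_vol CARD('d) \<delta>" for i
    using assms by (simp add: vol_torus_ball)
  moreover have "(\<Sum>i<p. measure lborel (Q i)) = 1"
    using vol_UN_disjoint[of "{..<p}" Q] * cube measure_unit_cube[where 'd = 'd]
    by (auto simp: disjoint_family_on_def)
  ultimately show ?thesis
    using that * by blast
qed

section \<open>Low-degree points of processes with Palm estimates\<close>

text \<open>The three estimates say that, up to constants, conditioning on a point in the infinitesimal cell
  \<open>Q\<close> adds that point and leaves the other points undisturbed.  \<open>F v\<close> is the probability that a ball of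
  volume \<open>v\<close> around a point of the process holds at most \<open>k - 1\<close> other points.  It has to be precise, as
  it gives the limit, whereas \<open>C\<close> may be any constant since it only affects pairs.  The error \<open>K\<close> may even
  depend on the intensity, because the cells are refined at fixed intensity.\<close>

locale palm_estimates = prob_space M
  for M :: "'a measure" +
  fixes N :: "'a \<Rightarrow> (real ^ 'd) multiset" and t C K :: real and k :: nat and F :: "real \<Rightarrow> real"
  assumes counts_measurable: "A \<in> sets borel \<Longrightarrow> (\<lambda>w. num_points (N w) A) \<in> measurable M (count_space UNIV)"
    and points_in_cube: "AE w in M. set_mset (N w) \<subseteq> unit_cube"
    and nonneg: "0 \<le> t" "0 \<le> C" "0 \<le> K"
    and k_pos: "1 \<le> k"
    and one_point_upper: "\<lbrakk>Q \<in> sets borel; B \<in> sets borel; Q \<subseteq> unit_cube; B \<subseteq> unit_cube; Q \<inter> B = {}\<rbrakk> \<Longrightarrow>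
      prob {w \<in> space M. 1 \<le> num_points (N w) Q \<and> num_points (N w) B \<le> k - 1}
        \<le> t * measure lborel Q * F (measure lborel B)"
    and one_point_lower: "\<lbrakk>Q \<in> sets borel; B \<in> sets borel; Q \<subseteq> B; B \<subseteq> unit_cube\<rbrakk> \<Longrightarrow>
      t * measure lborel Q * (F (measure lborel B) - K * measure lborel Q)
        \<le> prob {w \<in> space M. 1 \<le> num_points (N w) Q \<and> num_points (N w) B \<le> k}"
    and two_point_upper: "\<lbrakk>Q \<in> sets borel; Q' \<in> sets borel; B \<in> sets borel; D \<in> sets borel;
        Q \<subseteq> unit_cube; Q' \<subseteq> unit_cube; B \<subseteq> unit_cube; D \<subseteq> unit_cube;
        Q \<inter> Q' = {}; Q \<inter> B = {}; Q \<inter> D = {}; Q' \<inter> B = {}; Q' \<inter> D = {}; B \<inter> D = {}; m \<le> k; m' \<le> k\<rbrakk> \<Longrightarrow>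
      prob {w \<in> space M. 1 \<le> num_points (N w) Q \<and> 1 \<le> num_points (N w) Q'
                       \<and> num_points (N w) B \<le> m \<and> num_points (N w) D \<le> m'}
        \<le> C * t\<^sup>2 * measure lborel Q * measure lborel Q'
          * poisson_cdf m (t * measure lborel B) * poisson_cdf m' (t * measure lborel D)"
begin

definition low_degree_event :: "real \<Rightarrow> 'a set" where
  "low_degree_event r = {w \<in> space M. \<exists>x\<in>#N w. num_points (N w) (torus_ball r x) \<le> k}"

lemma count_events [measurable]:
  assumes "A \<in> sets borel"
  shows "{w \<in> space M. num_points (N w) A \<le> m} \<in> events"
    and "{w \<in> space M. m \<le> num_points (N w) A} \<in> events"
  using counts_measurable[OF assms] by measurable

text \<open>Only counts are known to be measurable.  As realisations are finite, the ball of radius \<open>r\<close>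
  around a low-degree point can be enlarged a little without taking in a further point, and its centre
  moved to a countable dense set.\<close>

lemma low_degree_event_measurable: "low_degree_event r \<in> events"
proof -
  obtain D :: "(real ^ 'd) set" where D: "countable D" "\<And>X. open X \<Longrightarrow> X \<noteq> {} \<Longrightarrow> \<exists>d\<in>D. d \<in> X"
    using countable_dense_setE by blast
  let ?h = "\<lambda>n::nat. 1 / real (Suc n)"
  let ?G = "\<lambda>n q. {w \<in> space M. 1 \<le> num_points (N w) (ball q (?h n))} \<inter>
      {w \<in> space M. num_points (N w) (torus_ball (r + ?h n) q) \<le> k}"
  have "low_degree_event r = (\<Union>n. \<Union>q\<in>D. ?G n q)"
  proof (intro equalityI subsetI)
    fix w assume "w \<in> low_degree_event r"
    then obtain x where w: "w \<in> space M" and x: "x \<in># N w" "num_points (N w) (torus_ball r x) \<le> k"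
      by (auto simp: low_degree_event_def)
    \<comment> \<open>The gaps between \<open>r\<close> and the distances of the points outside the ball; the element \<open>1\<close> only
      makes the minimum exist.\<close>
    define Y where "Y = insert 1 ((\<lambda>y. torus_dist x y - r) ` {y \<in> set_mset (N w). r < torus_dist x y})"
    have Y: "finite Y" "Y \<noteq> {}" "\<And>y. y \<in> Y \<Longrightarrow> 0 < y"
      by (auto simp: Y_def)
    then have "0 < Min Y"
      by simp
    then obtain n where n: "?h n < Min Y / 2"
      using nat_approx_posE[of "Min Y / 2"] by auto
    obtain q where q: "q \<in> D" "q \<in> ball x (?h n)"
      using D(2)[of "ball x (?h n)"] by auto
    have dist: "torus_dist x q < ?h n"
      using q(2) torus_dist_le_norm[of x q] by (simp add: dist_norm)
    have "torus_dist x y \<le> r" if "y \<in># N w" "torus_dist q y \<le> r + ?h n" for y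
    proof (rule ccontr)
      assume *: "\<not> torus_dist x y \<le> r"
      then have "Min Y \<le> torus_dist x y - r"
        using that by (intro Min_le) (auto simp: Y_def)
      moreover have "torus_dist x y \<le> torus_dist x q + torus_dist q y"
        by (rule torus_dist_triangle)
      ultimately show False
        using that(2) dist n by linarith
    qed
    then have "num_points (N w) (torus_ball (r + ?h n) q) \<le> num_points (N w) (torus_ball r x)"
      unfolding num_points_def torus_ball_def
      by (intro size_mset_mono) (auto intro!: filter_mset_mono_strong)
    moreover have "1 \<le> num_points (N w) (ball q (?h n))"
      unfolding num_points_ge_1_iff using x(1) q(2) by (auto simp: dist_commute)
    ultimately show "w \<in> (\<Union>n. \<Union>q\<in>D. ?G n q)"
      using w x(2) q(1) by (intro UN_I[of n] UN_I[of q]) auto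
  next
    fix w assume "w \<in> (\<Union>n. \<Union>q\<in>D. ?G n q)"
    then obtain n q where w: "w \<in> space M" "1 \<le> num_points (N w) (ball q (?h n))"
      "num_points (N w) (torus_ball (r + ?h n) q) \<le> k"
      by auto
    then obtain x where x: "x \<in># N w" "dist q x < ?h n"
      unfolding num_points_ge_1_iff by auto
    have "torus_ball r x \<subseteq> torus_ball (r + ?h n) q"
      using x(2) torus_dist_le_norm[of x q]
      by (intro torus_ball_mono) (auto simp: dist_norm norm_minus_commute)
    then have "num_points (N w) (torus_ball r x) \<le> k"
      using num_points_mono w(3) order_trans by blast
    then show "w \<in> low_degree_event r"
      using w(1) x(1) by (auto simp: low_degree_event_def)
  qed
  moreover have "(\<Union>n. \<Union>q\<in>D. ?G n q) \<in> events"
    using D(1) by (intro sets.countable_UN'' sets.Int count_events) auto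
  ultimately show ?thesis
    by simp
qed

text \<open>If \<open>x \<in> Q\<^sub>i\<close> has low degree, the cell \<open>Q\<^sub>i\<close> is occupied, and the ball of radius \<open>r - \<delta>\<close> around the centre
  of the cell lies in the ball around \<open>x\<close> and, without the cell, holds at most \<open>k - 1\<close> points.  Sum over the
  cells and let \<open>\<delta>\<close> tend to \<open>0\<close>.\<close>

lemma low_degree_prob_upper:
  assumes r: "0 < r" "r < 1/2" and cont: "isCont F (ball_vol CARD('d) r)"
  shows "prob (low_degree_event r) \<le> t * F (ball_vol CARD('d) r)"
proof -
  let ?V = "ball_vol CARD('d)"
  have bound: "prob (low_degree_event r) \<le> t * (F (?V r) + \<eta>)" if \<eta>: "0 < \<eta>" for \<eta>
  proof -
    obtain e where e: "0 < e" "\<And>b. dist b (?V r) < e \<Longrightarrow> dist (F b) (F (?V r)) < \<eta>"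
      using cont \<eta> unfolding continuous_at_eps_delta by blast
    have "((\<lambda>\<delta>. ?V r - ?V (r - \<delta>) + ?V \<delta>) \<longlongrightarrow> ?V r - ?V (r - 0) + ?V 0) (at_right 0)"
      by (intro tendsto_intros)
    then have "((\<lambda>\<delta>. ?V r - ?V (r - \<delta>) + ?V \<delta>) \<longlongrightarrow> 0) (at_right 0)"
      by (simp add: ball_vol_0)
    then have "eventually (\<lambda>\<delta>. ?V r - ?V (r - \<delta>) + ?V \<delta> < e) (at_right 0)"
      using e(1) by (rule order_tendstoD)
    moreover have "eventually (\<lambda>\<delta>. 0 < \<delta> \<and> \<delta> < r) (at_right (0::real))"
      using eventually_at_right_real[OF r(1)] by simp
    ultimately have "eventually (\<lambda>\<delta>. ?V r - ?V (r - \<delta>) + ?V \<delta> < e \<and> 0 < \<delta> \<and> \<delta> < r) (at_right 0)"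
      by eventually_elim auto
    then obtain \<delta> where \<delta>: "?V r - ?V (r - \<delta>) + ?V \<delta> < e" "0 < \<delta>" "\<delta> < r"
      using eventually_happens'[OF trivial_limit_at_right_real] by blast
    obtain p and Q :: "nat \<Rightarrow> (real ^ 'd) set" and q where Q:
      "disjoint_family Q" "\<And>i. Q i \<in> sets borel" "(\<Union>i<p. Q i) = unit_cube"
      "\<And>i. Q i \<subseteq> torus_ball \<delta> (q i)" "\<And>i. measure lborel (Q i) \<le> ?V \<delta>"
      "(\<Sum>i<p. measure lborel (Q i)) = 1"
      by (rule fine_cube_partition[where 'd = 'd, OF \<delta>(2) less_trans[OF \<delta>(3) r(2)]])
        (rule that; assumption)
    define B where "B i = torus_ball (r - \<delta>) (q i) - Q i" for i
    have Qc: "Q i \<subseteq> unit_cube" for i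
      using Q(4) torus_ball_subset_cube by blast
    have B: "B i \<in> sets borel" "B i \<subseteq> unit_cube" "Q i \<inter> B i = {}" for i
      using Q(2) torus_ball_subset_cube by (auto simp: B_def)
    let ?A = "\<lambda>i. {w \<in> space M. 1 \<le> num_points (N w) (Q i) \<and> num_points (N w) (B i) \<le> k - 1}"
    have A: "?A i \<in> events" for i
      using Q(2) B(1) by (intro sets.sets_Collect_conj count_events)
    have FB: "F (measure lborel (B i)) \<le> F (?V r) + \<eta>" for i
    proof -
      have "?V (r - \<delta>) - ?V \<delta> \<le> measure lborel (B i)"
        using vol_Diff_ge[OF torus_ball_borel torus_ball_subset_cube Q(2) Qc, of "r - \<delta>" "q i" i] Q(5)[of i] \<delta> r
        by (simp add: B_def vol_torus_ball)
      moreover have "measure lborel (B i) \<le> ?V (r - \<delta>)"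
        using vol_mono_in_cube[OF _ B(1) torus_ball_borel torus_ball_subset_cube, of i "r - \<delta>" "q i"] \<delta> r
        by (simp add: B_def vol_torus_ball Diff_subset)
      moreover have "?V (r - \<delta>) \<le> ?V r"
        using \<delta> by (intro ball_vol_mono) auto
      ultimately have "dist (measure lborel (B i)) (?V r) < e"
        using \<delta>(1) ball_vol_nonneg[of \<delta> "CARD('d)"] \<delta>(2) by (auto simp: dist_real_def)
      then show ?thesis
        using e(2) by (force simp: dist_real_def)
    qed
    have "AE w in M. w \<in> low_degree_event r \<longrightarrow> w \<in> (\<Union>i<p. ?A i)"
      using points_in_cube
    proof eventually_elim
      case (elim w)
      show ?case
      proof
        assume "w \<in> low_degree_event r"
        then obtain x where w: "w \<in> space M" and x: "x \<in># N w" "num_points (N w) (torus_ball r x) \<le> k"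
          by (auto simp: low_degree_event_def)
        obtain i where i: "i < p" "x \<in> Q i"
          using elim x(1) Q(3) by blast
        have dist: "torus_dist (q i) x \<le> \<delta>"
          using i(2) Q(4) by (auto simp: torus_ball_def)
        have "x \<in> torus_ball r x"
          using elim x(1) r(1) by (auto simp: torus_ball_def)
        then have "num_points (N w) (torus_ball r x - {x}) + 1 \<le> num_points (N w) (torus_ball r x)"
          using x(1) by (intro num_points_remove) (simp_all only: num_points_ge_1_iff, auto)
        moreover have "B i \<subseteq> torus_ball r x - {x}"
          using torus_ball_mono[of "q i" x "r - \<delta>" r] dist i(2) by (auto simp: B_def)
        then have "num_points (N w) (B i) \<le> num_points (N w) (torus_ball r x - {x})"
          by (rule num_points_mono)
        ultimately have "num_points (N w) (B i) \<le> k - 1"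
          using x(2) by linarith
        moreover have "1 \<le> num_points (N w) (Q i)"
          unfolding num_points_ge_1_iff using x(1) i(2) by auto
        ultimately show "w \<in> (\<Union>i<p. ?A i)"
          using w i(1) by auto
      qed
    qed
    then have "prob (low_degree_event r) \<le> prob (\<Union>i<p. ?A i)"
      using A by (intro finite_measure_mono_AE) auto
    also have "\<dots> \<le> (\<Sum>i<p. prob (?A i))"
      using A by (intro finite_measure_subadditive_finite) auto
    also have "\<dots> \<le> (\<Sum>i<p. t * measure lborel (Q i) * (F (?V r) + \<eta>))"
    proof (rule sum_mono)
      fix i
      have "prob (?A i) \<le> t * measure lborel (Q i) * F (measure lborel (B i))"
        using Q(2) B Qc by (intro one_point_upper)
      also have "\<dots> \<le> t * measure lborel (Q i) * (F (?V r) + \<eta>)"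
        using FB nonneg by (intro mult_left_mono) auto
      finally show "prob (?A i) \<le> t * measure lborel (Q i) * (F (?V r) + \<eta>)" .
    qed
    also have "\<dots> = t * (F (?V r) + \<eta>)"
      by (simp add: sum_distrib_left[symmetric] sum_distrib_right[symmetric] Q(6))
    finally show ?thesis .
  qed
  have "((\<lambda>\<eta>. t * (F (?V r) + \<eta>)) \<longlongrightarrow> t * (F (?V r) + 0)) (at_right 0)"
    by (intro tendsto_intros)
  then have "prob (low_degree_event r) \<le> t * (F (?V r) + 0)"
    by (rule tendsto_lowerbound) (auto intro!: eventually_at_rightI[of 0 1] bound)
  then show ?thesis by simp
qed


text \<open>The three terms correspond to the three ranges of the distance of the two centres.  The radius
  \<open>r + 2\<delta>\<close> leaves room for an exact bound: by \<open>ball_vol_enlarge\<close> the larger ball, with both cells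
  removed, still has at least the volume of a ball of radius \<open>r\<close>.\<close>

lemma low_degree_pair_upper:
  fixes Q Q' :: "(real ^ 'd) set"
  assumes r: "0 < r" and \<delta>: "0 < \<delta>" and \<epsilon>: "0 < \<epsilon>" "\<epsilon> \<le> 1"
    and \<rho>: "r + 2 * \<delta> < 3/14" and small: "2 * ball_vol CARD('d) \<delta> \<le> ball_vol CARD('d) (\<epsilon> * r / 3)"
    and Q: "Q \<in> sets borel" "Q \<subseteq> torus_ball \<delta> q"
    and Q': "Q' \<in> sets borel" "Q' \<subseteq> torus_ball \<delta> q'"
    and disj: "Q \<inter> Q' = {}"
  defines "V \<equiv> ball_vol CARD('d)"
  shows "prob ({w \<in> space M. 1 \<le> num_points (N w) Q \<and> num_points (N w) (torus_ball (r + 2 * \<delta>) q) \<le> k}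
            \<inter> {w \<in> space M. 1 \<le> num_points (N w) Q' \<and> num_points (N w) (torus_ball (r + 2 * \<delta>) q') \<le> k})
       \<le> C * t\<^sup>2 * measure lborel Q * measure lborel Q' *
          (of_bool (torus_dist q q' \<le> \<epsilon> * r) * (of_bool (2 \<le> k) * poisson_cdf (k - 2) (t * V r))
         + of_bool (torus_dist q q' \<le> 2 * (r + 2 * \<delta>))
             * (poisson_cdf (k - 1) (t * V r) * poisson_cdf (k - 1) (t * (V (\<epsilon> * r / 3) - 2 * V \<delta>)))
         + (poisson_cdf (k - 1) (t * V r))\<^sup>2)" (is "prob (?A \<inter> ?A') \<le> ?c * (?near + ?middle + ?far)")
proof -
  define \<rho>' where "\<rho>' = r + 2 * \<delta>"
  define h where "h = torus_dist q q'"
  have A: "?A \<inter> ?A' = {w \<in> space M. 1 \<le> num_points (N w) Q \<and> num_points (N w) (torus_ball \<rho>' q) \<le> k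
      \<and> 1 \<le> num_points (N w) Q' \<and> num_points (N w) (torus_ball \<rho>' q') \<le> k}"
    by (auto simp: \<rho>'_def)
  have Vnn: "0 \<le> V s" if "0 \<le> s" for s
    using that by (simp add: V_def ball_vol_nonneg)
  have \<epsilon>r: "\<epsilon> * r \<le> r"
    using \<epsilon> r by simp
  have cube: "Q \<subseteq> unit_cube" "Q' \<subseteq> unit_cube"
    using Q(2) Q'(2) torus_ball_subset_cube[of \<delta> q] torus_ball_subset_cube[of \<delta> q'] by auto
  have sub: "Q \<subseteq> torus_ball \<rho>' q" "Q' \<subseteq> torus_ball \<rho>' q'"
    using Q(2) Q'(2) torus_ball_mono[of q q \<delta> \<rho>'] torus_ball_mono[of q' q' \<delta> \<rho>'] r \<delta>
    by (auto simp: \<rho>'_def)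
  have QV: "measure lborel Q \<le> V \<delta>" "measure lborel Q' \<le> V \<delta>"
    using vol_mono_in_cube[OF Q(2) Q(1) torus_ball_borel torus_ball_subset_cube]
      vol_mono_in_cube[OF Q'(2) Q'(1) torus_ball_borel torus_ball_subset_cube] \<delta> \<rho> r
    by (simp_all add: V_def vol_torus_ball)
  have removed: "V s - 2 * V \<delta> \<le> measure lborel (torus_ball s c - (Q \<union> Q'))"
    if "0 \<le> s" "s < 1/2" for s c
  proof -
    have "measure lborel (Q \<union> Q') \<le> 2 * V \<delta>"
      using measure_Un_le[of Q lborel Q'] Q(1) Q'(1) QV by simp
    moreover have "V s - measure lborel (Q \<union> Q') \<le> measure lborel (torus_ball s c - (Q \<union> Q'))"
      using vol_Diff_ge[OF torus_ball_borel torus_ball_subset_cube, of "Q \<union> Q'" s c] that cube Q(1) Q'(1)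
      by (simp add: V_def vol_torus_ball)
    ultimately show ?thesis by linarith
  qed
  define B where "B = torus_ball \<rho>' q - (Q \<union> Q')"
  have B: "B \<in> sets borel" "B \<subseteq> unit_cube"
    using Q(1) Q'(1) torus_ball_subset_cube by (auto simp: B_def)
  have BV: "V r \<le> measure lborel B"
    using removed[of \<rho>' q] ball_vol_enlarge[of "CARD('d)" r \<delta>] r \<delta> \<rho>
    by (simp add: B_def V_def \<rho>'_def)
  have cdfB: "poisson_cdf m (t * measure lborel B) \<le> poisson_cdf m (t * V r)" for m
    using BV nonneg Vnn[of r] r by (intro poisson_cdf_antimono mult_left_mono mult_nonneg_nonneg) auto
  have cnn: "0 \<le> ?c"
    using nonneg by simp
  have tnn: "0 \<le> t * V r" "0 \<le> t * (V (\<epsilon> * r / 3) - 2 * V \<delta>)"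
    using nonneg Vnn r small by (auto simp: V_def)
  have parts: "0 \<le> ?near" "0 \<le> ?middle" "0 \<le> ?far"
    using tnn by (auto intro!: mult_nonneg_nonneg poisson_cdf_nonneg)
  \<comment> \<open>Each cell contributes a point to its own ball, so at most \<open>k - 1\<close> points remain both for the first
    ball and for any part \<open>D\<close> of the second ball that avoids the first.\<close>
  have two: "prob (?A \<inter> ?A') \<le> ?c * (poisson_cdf (k - 1) (t * V r) * poisson_cdf (k - 1) (t * v))"
    if D: "D \<subseteq> torus_ball \<rho>' q'" "D \<inter> torus_ball \<rho>' q = {}" "D \<inter> Q' = {}" "D \<in> sets borel"
      and v: "0 \<le> v" "v \<le> measure lborel D" for D v
  proof -
    have Dc: "D \<subseteq> unit_cube"
      using D(1) torus_ball_subset_cube[of \<rho>' q'] by auto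
    have "?A \<inter> ?A' \<subseteq> {w \<in> space M. 1 \<le> num_points (N w) Q \<and> 1 \<le> num_points (N w) Q'
                       \<and> num_points (N w) B \<le> k - 1 \<and> num_points (N w) D \<le> k - 1}"
    proof
      fix w assume "w \<in> ?A \<inter> ?A'"
      then have w: "w \<in> space M" "1 \<le> num_points (N w) Q" "num_points (N w) (torus_ball \<rho>' q) \<le> k"
        "1 \<le> num_points (N w) Q'" "num_points (N w) (torus_ball \<rho>' q') \<le> k"
        unfolding A by auto
      have "num_points (N w) B \<le> num_points (N w) (torus_ball \<rho>' q - Q)"
        by (rule num_points_mono) (auto simp: B_def)
      moreover have "num_points (N w) (torus_ball \<rho>' q - Q) + 1 \<le> num_points (N w) (torus_ball \<rho>' q)"
        by (rule num_points_remove[OF w(2) sub(1)])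
      moreover have "num_points (N w) D \<le> num_points (N w) (torus_ball \<rho>' q' - Q')"
        by (rule num_points_mono) (use D in auto)
      moreover have "num_points (N w) (torus_ball \<rho>' q' - Q') + 1 \<le> num_points (N w) (torus_ball \<rho>' q')"
        by (rule num_points_remove[OF w(4) sub(2)])
      ultimately show "w \<in> {w \<in> space M. 1 \<le> num_points (N w) Q \<and> 1 \<le> num_points (N w) Q'
                       \<and> num_points (N w) B \<le> k - 1 \<and> num_points (N w) D \<le> k - 1}"
        using w by auto
    qed
    then have "prob (?A \<inter> ?A') \<le> prob {w \<in> space M. 1 \<le> num_points (N w) Q \<and> 1 \<le> num_points (N w) Q'
                       \<and> num_points (N w) B \<le> k - 1 \<and> num_points (N w) D \<le> k - 1}"
      using Q Q' B D by (intro finite_measure_mono sets.sets_Collect_conj count_events) auto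
    also have "\<dots> \<le> ?c * poisson_cdf (k - 1) (t * measure lborel B) * poisson_cdf (k - 1) (t * measure lborel D)"
      using Q(1) Q'(1) B D Dc cube disj sub by (intro two_point_upper) (auto simp: B_def)
    also have "\<dots> \<le> ?c * (poisson_cdf (k - 1) (t * V r) * poisson_cdf (k - 1) (t * v))"
    proof -
      have "poisson_cdf (k - 1) (t * measure lborel D) \<le> poisson_cdf (k - 1) (t * v)"
        using v nonneg by (intro poisson_cdf_antimono mult_left_mono mult_nonneg_nonneg) auto
      then have "poisson_cdf (k - 1) (t * measure lborel B) * poisson_cdf (k - 1) (t * measure lborel D)
          \<le> poisson_cdf (k - 1) (t * V r) * poisson_cdf (k - 1) (t * v)"
        using cdfB[of "k - 1"] nonneg by (intro mult_mono poisson_cdf_nonneg[OF tnn(1)] poisson_cdf_nonneg) auto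
      then show ?thesis
        unfolding mult.assoc[of ?c] using cnn by (rule mult_left_mono)
    qed
    finally show ?thesis .
  qed
  consider "h \<le> \<epsilon> * r" | "\<epsilon> * r < h" "h \<le> 2 * \<rho>'" | "2 * \<rho>' < h"
    by linarith
  then have "\<exists>x\<in>{?near, ?middle, ?far}. prob (?A \<inter> ?A') \<le> ?c * x"
  proof cases
    case 1
    have "Q' \<subseteq> torus_ball \<rho>' q"
      using Q'(2) torus_ball_mono[of q' q \<delta> \<rho>'] 1 \<epsilon>r \<delta> torus_dist_commute[of q q'] by (auto simp: \<rho>'_def h_def)
    then have Q'B: "Q' \<subseteq> torus_ball \<rho>' q - Q"
      using disj by auto
    have B2: "num_points (N w) B + 2 \<le> num_points (N w) (torus_ball \<rho>' q)"
      if "1 \<le> num_points (N w) Q" "1 \<le> num_points (N w) Q'" for w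
    proof -
      have "B = torus_ball \<rho>' q - Q - Q'"
        by (auto simp: B_def)
      then show ?thesis
        using num_points_remove[OF that(1) sub(1)] num_points_remove[OF that(2) Q'B] by simp
    qed
    show ?thesis
    proof (cases "2 \<le> k")
      case True
      have "?A \<inter> ?A' \<subseteq> {w \<in> space M. 1 \<le> num_points (N w) Q \<and> 1 \<le> num_points (N w) Q'
                       \<and> num_points (N w) B \<le> k - 2 \<and> num_points (N w) {} \<le> 0}"
        unfolding A using B2 by fastforce
      then have "prob (?A \<inter> ?A') \<le> prob {w \<in> space M. 1 \<le> num_points (N w) Q \<and> 1 \<le> num_points (N w) Q'
                       \<and> num_points (N w) B \<le> k - 2 \<and> num_points (N w) {} \<le> 0}"
        using Q Q' B by (intro finite_measure_mono sets.sets_Collect_conj count_events) auto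
      also have "\<dots> \<le> ?c * poisson_cdf (k - 2) (t * measure lborel B) * poisson_cdf 0 (t * measure lborel ({} :: (real ^ 'd) set))"
        using Q(1) Q'(1) B cube disj by (intro two_point_upper) (auto simp: B_def)
      also have "\<dots> \<le> ?c * ?near"
        using cnn cdfB[of "k - 2"] 1 True by (auto intro!: mult_left_mono simp: h_def)
      finally show ?thesis by blast
    next
      case False
      have "?A \<inter> ?A' = {}"
        unfolding A using B2 False k_pos by fastforce
      then show ?thesis
        using cnn parts by auto
    qed
  next
    case 2
    then have h0: "0 < torus_dist q q'"
      using \<epsilon>(1) r by (auto simp: h_def intro: le_less_trans[rotated])
    obtain c where c: "torus_ball (h / 3) c \<subseteq> torus_ball \<rho>' q'" "torus_ball (h / 3) c \<inter> torus_ball \<rho>' q = {}"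
      using torus_ball_difference_contains_ball[OF h0, of \<rho>'] 2(2) \<rho> unfolding h_def \<rho>'_def by blast
    have "V (\<epsilon> * r / 3) \<le> V (h / 3)"
      unfolding V_def using 2(1) \<epsilon> r by (intro ball_vol_mono) auto
    then have "V (\<epsilon> * r / 3) - 2 * V \<delta> \<le> measure lborel (torus_ball (h / 3) c - (Q \<union> Q'))"
      using removed[of "h / 3" c] h0 2(2) \<rho> by (simp add: h_def \<rho>'_def)
    then have "prob (?A \<inter> ?A') \<le> ?c * (poisson_cdf (k - 1) (t * V r) * poisson_cdf (k - 1) (t * (V (\<epsilon> * r / 3) - 2 * V \<delta>)))"
      using c small Q(1) Q'(1) by (intro two) (auto simp: V_def)
    then show ?thesis
      using 2(2) by (simp add: h_def \<rho>'_def)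
  next
    case 3
    have "torus_ball \<rho>' q' \<inter> torus_ball \<rho>' q = {}"
      using torus_ball_disjoint[of \<rho>' \<rho>' q q'] 3 by (auto simp: h_def)
    moreover have "V r \<le> measure lborel (torus_ball \<rho>' q' - (Q \<union> Q'))"
      using removed[of \<rho>' q'] ball_vol_enlarge[of "CARD('d)" r \<delta>] r \<delta> \<rho>
      by (simp add: V_def \<rho>'_def)
    ultimately have "prob (?A \<inter> ?A') \<le> ?c * (poisson_cdf (k - 1) (t * V r) * poisson_cdf (k - 1) (t * V r))"
      using Q(1) Q'(1) Vnn[of r] r by (intro two[of "torus_ball \<rho>' q' - (Q \<union> Q')"]) auto
    then show ?thesis
      by (simp add: power2_eq_square)
  qed
  then obtain x where x: "x \<in> {?near, ?middle, ?far}" "prob (?A \<inter> ?A') \<le> ?c * x"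
    by blast
  have "x \<le> ?near + ?middle + ?far"
    using x(1) parts by auto
  then have "?c * x \<le> ?c * (?near + ?middle + ?far)"
    using cnn by (rule mult_left_mono)
  with x(2) show ?thesis
    by (rule order_trans)
qed

text \<open>An occupied cell whose enlarged ball holds at most \<open>k\<close> points contains a low-degree point.  In the
  Bonferroni inequality for these events, the cells with centres within distance \<open>s\<close> of a given one are
  disjoint and lie in a ball of radius \<open>s + \<delta>\<close>, which bounds the sum over the second cell.\<close>

lemma low_degree_prob_lower_mesh:
  assumes r: "0 < r" and \<delta>: "0 < \<delta>" and \<epsilon>: "0 < \<epsilon>" "\<epsilon> \<le> 1"
    and \<rho>: "2 * (r + 2 * \<delta>) + \<delta> < 3/7" and small: "2 * ball_vol CARD('d) \<delta> \<le> ball_vol CARD('d) (\<epsilon> * r / 3)"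
  defines "V \<equiv> ball_vol CARD('d)"
  shows "t * (F (V (r + 2 * \<delta>)) - K * V \<delta>)
       - C * t\<^sup>2 * (V (\<epsilon> * r + \<delta>) * (of_bool (2 \<le> k) * poisson_cdf (k - 2) (t * V r))
         + V (2 * (r + 2 * \<delta>) + \<delta>)
             * (poisson_cdf (k - 1) (t * V r) * poisson_cdf (k - 1) (t * (V (\<epsilon> * r / 3) - 2 * V \<delta>)))
         + (poisson_cdf (k - 1) (t * V r))\<^sup>2)
       \<le> prob (low_degree_event r)"
proof -
  obtain p and Q :: "nat \<Rightarrow> (real ^ 'd) set" and q where Q:
    "disjoint_family Q" "\<And>i. Q i \<in> sets borel" "(\<Union>i<p. Q i) = unit_cube"
    "\<And>i. Q i \<subseteq> torus_ball \<delta> (q i)" "\<And>i. measure lborel (Q i) \<le> ball_vol CARD('d) \<delta>"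
    "(\<Sum>i<p. measure lborel (Q i)) = 1"
  proof (rule fine_cube_partition[where 'd = 'd, OF \<delta>])
    show "\<delta> < 1/2"
      using r \<delta> \<rho> by argo
  qed (rule that; assumption)
  have \<epsilon>r: "\<epsilon> * r \<le> r"
    using \<epsilon> r by simp
  have Vnn: "0 \<le> V s" if "0 \<le> s" for s
    using that by (simp add: V_def ball_vol_nonneg)
  have Qc: "Q i \<subseteq> unit_cube" for i
    using Q(4)[of i] torus_ball_subset_cube by (rule subset_trans)
  let ?v = "\<lambda>i. measure lborel (Q i)"
  let ?A = "\<lambda>i. {w \<in> space M. 1 \<le> num_points (N w) (Q i) \<and> num_points (N w) (torus_ball (r + 2 * \<delta>) (q i)) \<le> k}"
  define P1 P2 P3 where "P1 = of_bool (2 \<le> k) * poisson_cdf (k - 2) (t * V r)"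
    and "P2 = poisson_cdf (k - 1) (t * V r) * poisson_cdf (k - 1) (t * (V (\<epsilon> * r / 3) - 2 * V \<delta>))"
    and "P3 = (poisson_cdf (k - 1) (t * V r))\<^sup>2"
  define near where "near s i = (\<Sum>j<p. ?v j * of_bool (torus_dist (q i) (q j) \<le> s))" for s i
  have tnn: "0 \<le> t * V r" "0 \<le> t * (V (\<epsilon> * r / 3) - 2 * V \<delta>)"
    using nonneg Vnn r small by (auto simp: V_def)
  then have P: "0 \<le> P1" "0 \<le> P2" "0 \<le> P3"
    by (auto simp: P1_def P2_def P3_def intro!: mult_nonneg_nonneg poisson_cdf_nonneg)
  have Aev: "?A i \<in> events" for i
    using Q(2) by (intro sets.sets_Collect_conj count_events) auto
  have near: "near s i \<le> V (s + \<delta>)" if s: "0 \<le> s" "s + \<delta> < 1/2" for s i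
  proof -
    let ?J = "{j. j < p \<and> torus_dist (q i) (q j) \<le> s}"
    have "near s i = (\<Sum>j\<in>?J. ?v j)"
      unfolding near_def by (rule sum.mono_neutral_cong_right) auto
    also have "\<dots> = measure lborel (\<Union>j\<in>?J. Q j)"
      using Q Qc by (intro vol_UN_disjoint[symmetric]) (auto simp: disjoint_family_on_def)
    also have "\<dots> \<le> measure lborel (torus_ball (s + \<delta>) (q i))"
    proof (rule vol_mono_in_cube)
      have "Q j \<subseteq> torus_ball (s + \<delta>) (q i)" if "torus_dist (q i) (q j) \<le> s" for j
        using Q(4)[of j] torus_ball_mono[of "q j" "q i" \<delta> "s + \<delta>"] that torus_dist_commute[of "q i" "q j"]
        by auto
      then show "(\<Union>j\<in>?J. Q j) \<subseteq> torus_ball (s + \<delta>) (q i)"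
        by auto
    qed (use Q(2) torus_ball_subset_cube in auto)
    also have "\<dots> = V (s + \<delta>)"
      using s \<delta> by (simp add: V_def vol_torus_ball)
    finally show ?thesis .
  qed
  have single: "t * (F (V (r + 2 * \<delta>)) - K * V \<delta>) * ?v i \<le> prob (?A i)" for i
  proof -
    have "t * (F (V (r + 2 * \<delta>)) - K * V \<delta>) * ?v i = t * ?v i * (F (V (r + 2 * \<delta>)) - K * V \<delta>)"
      by simp
    also have "\<dots> \<le> t * ?v i * (F (V (r + 2 * \<delta>)) - K * ?v i)"
      using nonneg Q(5)[of i] by (intro mult_left_mono diff_left_mono) (auto simp: V_def)
    also have "\<dots> \<le> prob (?A i)"
    proof -
      have "V (r + 2 * \<delta>) = measure lborel (torus_ball (r + 2 * \<delta>) (q i))"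
        using r \<delta> \<rho> by (simp add: V_def vol_torus_ball)
      moreover have "Q i \<subseteq> torus_ball (r + 2 * \<delta>) (q i)"
        using Q(4)[of i] torus_ball_mono[of "q i" "q i" \<delta> "r + 2 * \<delta>"] r \<delta> by auto
      ultimately show ?thesis
        using one_point_lower[OF Q(2) torus_ball_borel _ torus_ball_subset_cube] by simp
    qed
    finally show ?thesis .
  qed
  have pair: "prob (?A i \<inter> ?A j) \<le> C * t\<^sup>2 * ?v i * (?v j * of_bool (torus_dist (q i) (q j) \<le> \<epsilon> * r) * P1
      + ?v j * of_bool (torus_dist (q i) (q j) \<le> 2 * (r + 2 * \<delta>)) * P2 + ?v j * P3)" if "i \<noteq> j" for i j
  proof -
    have "Q i \<inter> Q j = {}"
      using Q(1) that by (auto simp: disjoint_family_on_def)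
    moreover have "r + 2 * \<delta> < 3/14"
      using \<rho> \<delta> by simp
    ultimately show ?thesis
      using low_degree_pair_upper[OF r \<delta> \<epsilon> _ small Q(2) Q(4) Q(2) Q(4), of i j]
      unfolding P1_def P2_def P3_def V_def by (simp add: algebra_simps)
  qed
  have pairs: "(\<Sum>i<p. \<Sum>j\<in>{..<p} - {i}. prob (?A i \<inter> ?A j))
      \<le> C * t\<^sup>2 * (V (\<epsilon> * r + \<delta>) * P1 + V (2 * (r + 2 * \<delta>) + \<delta>) * P2 + P3)"
  proof -
    have "(\<Sum>j\<in>{..<p} - {i}. prob (?A i \<inter> ?A j))
        \<le> C * t\<^sup>2 * ?v i * (V (\<epsilon> * r + \<delta>) * P1 + V (2 * (r + 2 * \<delta>) + \<delta>) * P2 + P3)" for i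
    proof -
      let ?g = "\<lambda>j. ?v j * of_bool (torus_dist (q i) (q j) \<le> \<epsilon> * r) * P1
        + ?v j * of_bool (torus_dist (q i) (q j) \<le> 2 * (r + 2 * \<delta>)) * P2 + ?v j * P3"
      have "(\<Sum>j\<in>{..<p} - {i}. prob (?A i \<inter> ?A j)) \<le> (\<Sum>j\<in>{..<p} - {i}. C * t\<^sup>2 * ?v i * ?g j)"
        using pair by (intro sum_mono) auto
      also have "\<dots> \<le> (\<Sum>j<p. C * t\<^sup>2 * ?v i * ?g j)"
        using nonneg P by (intro sum_mono2) (auto intro!: mult_nonneg_nonneg add_nonneg_nonneg)
      also have "\<dots> = C * t\<^sup>2 * ?v i * (\<Sum>j<p. ?g j)"
        by (rule sum_distrib_left[symmetric])
      also have "(\<Sum>j<p. ?g j) = near (\<epsilon> * r) i * P1 + near (2 * (r + 2 * \<delta>)) i * P2 + P3"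
        using Q(6) by (simp add: near_def sum.distrib sum_distrib_right[symmetric])
      also have "C * t\<^sup>2 * ?v i * \<dots> \<le> C * t\<^sup>2 * ?v i * (V (\<epsilon> * r + \<delta>) * P1 + V (2 * (r + 2 * \<delta>) + \<delta>) * P2 + P3)"
      proof (intro mult_left_mono add_mono mult_right_mono order_refl P mult_nonneg_nonneg)
        have "\<epsilon> * r + \<delta> < 1/2"
          using \<epsilon>r r \<delta> \<rho> by argo
        then show "near (\<epsilon> * r) i \<le> V (\<epsilon> * r + \<delta>)"
          using \<epsilon> r by (intro near) auto
        show "near (2 * (r + 2 * \<delta>)) i \<le> V (2 * (r + 2 * \<delta>) + \<delta>)"
          using r \<delta> \<rho> by (intro near) auto
      qed (use nonneg in auto)
      finally show ?thesis .
    qed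
    then have "(\<Sum>i<p. \<Sum>j\<in>{..<p} - {i}. prob (?A i \<inter> ?A j))
        \<le> (\<Sum>i<p. C * t\<^sup>2 * ?v i * (V (\<epsilon> * r + \<delta>) * P1 + V (2 * (r + 2 * \<delta>) + \<delta>) * P2 + P3))"
      by (rule sum_mono)
    also have "\<dots> = C * t\<^sup>2 * (V (\<epsilon> * r + \<delta>) * P1 + V (2 * (r + 2 * \<delta>) + \<delta>) * P2 + P3)"
      by (simp only: sum_distrib_left[symmetric] sum_distrib_right[symmetric] Q(6) mult_1_right)
    finally show ?thesis .
  qed
  have "t * (F (V (r + 2 * \<delta>)) - K * V \<delta>) = (\<Sum>i<p. t * (F (V (r + 2 * \<delta>)) - K * V \<delta>) * ?v i)"
    by (simp only: sum_distrib_left[symmetric] Q(6) mult_1_right)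
  also have "\<dots> \<le> (\<Sum>i<p. prob (?A i))"
    by (rule sum_mono[OF single])
  finally have "t * (F (V (r + 2 * \<delta>)) - K * V \<delta>)
      - C * t\<^sup>2 * (V (\<epsilon> * r + \<delta>) * P1 + V (2 * (r + 2 * \<delta>) + \<delta>) * P2 + P3)
    \<le> (\<Sum>i<p. prob (?A i)) - (\<Sum>i<p. \<Sum>j\<in>{..<p} - {i}. prob (?A i \<inter> ?A j))"
    using pairs by linarith
  also have "\<dots> \<le> prob (\<Union>i<p. ?A i)"
    using Aev by (intro bonferroni_lower) auto
  also have "\<dots> \<le> prob (low_degree_event r)"
  proof (rule finite_measure_mono[OF _ low_degree_event_measurable])
    show "(\<Union>i<p. ?A i) \<subseteq> low_degree_event r"
    proof
      fix w assume "w \<in> (\<Union>i<p. ?A i)"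
      then obtain i where w: "w \<in> space M" "1 \<le> num_points (N w) (Q i)"
        "num_points (N w) (torus_ball (r + 2 * \<delta>) (q i)) \<le> k"
        by blast
      then obtain x where x: "x \<in># N w" "x \<in> Q i"
        unfolding num_points_ge_1_iff by blast
      have "torus_dist (q i) x \<le> \<delta>"
        using x(2) Q(4)[of i] by (auto simp: torus_ball_def)
      then have "torus_ball r x \<subseteq> torus_ball (r + 2 * \<delta>) (q i)"
        using \<delta> torus_dist_commute[of "q i" x] by (intro torus_ball_mono) auto
      then have "num_points (N w) (torus_ball r x) \<le> k"
        using w(3) num_points_mono order_trans by blast
      then show "w \<in> low_degree_event r"
        using w(1) x(1) by (auto simp: low_degree_event_def)
    qed
  qed
  finally show ?thesis
    unfolding P1_def P2_def P3_def .
qed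

lemma low_degree_prob_lower:
  assumes r: "0 < r" "r < 3/14" and \<epsilon>: "0 < \<epsilon>" "\<epsilon> \<le> 1" and cont: "isCont F (ball_vol CARD('d) r)"
  defines "V \<equiv> ball_vol CARD('d)"
  shows "t * F (V r)
       - C * t\<^sup>2 * (V (\<epsilon> * r) * (of_bool (2 \<le> k) * poisson_cdf (k - 2) (t * V r))
         + V (2 * r) * (poisson_cdf (k - 1) (t * V r) * poisson_cdf (k - 1) (t * V (\<epsilon> * r / 3)))
         + (poisson_cdf (k - 1) (t * V r))\<^sup>2)
       \<le> prob (low_degree_event r)"
proof -
  define f where "f \<delta> = t * (F (V (r + 2 * \<delta>)) - K * V \<delta>)
       - C * t\<^sup>2 * (V (\<epsilon> * r + \<delta>) * (of_bool (2 \<le> k) * poisson_cdf (k - 2) (t * V r))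
         + V (2 * (r + 2 * \<delta>) + \<delta>)
             * (poisson_cdf (k - 1) (t * V r) * poisson_cdf (k - 1) (t * (V (\<epsilon> * r / 3) - 2 * V \<delta>)))
         + (poisson_cdf (k - 1) (t * V r))\<^sup>2)" for \<delta>
  have V: "((\<lambda>\<delta>. V (g \<delta>)) \<longlongrightarrow> V c) G" if "(g \<longlongrightarrow> c) G" for g :: "real \<Rightarrow> real" and c G
    unfolding V_def using that by (rule tendsto_ball_vol)
  have 1: "((\<lambda>\<delta>. V (r + 2 * \<delta>)) \<longlongrightarrow> V (r + 2 * 0)) (at_right 0)"
    unfolding V_def by (intro tendsto_intros)
  have 2: "((\<lambda>\<delta>. F (V (r + 2 * \<delta>))) \<longlongrightarrow> F (V r)) (at_right 0)"
    using isCont_tendsto_compose[OF cont, of "\<lambda>\<delta>. V (r + 2 * \<delta>)" "at_right 0"] 1 by (simp add: V_def)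
  have "(f \<longlongrightarrow> t * (F (V r) - K * V 0)
       - C * t\<^sup>2 * (V (\<epsilon> * r + 0) * (of_bool (2 \<le> k) * poisson_cdf (k - 2) (t * V r))
         + V (2 * (r + 2 * 0) + 0)
             * (poisson_cdf (k - 1) (t * V r) * poisson_cdf (k - 1) (t * (V (\<epsilon> * r / 3) - 2 * V 0)))
         + (poisson_cdf (k - 1) (t * V r))\<^sup>2)) (at_right 0)"
    unfolding f_def by (intro tendsto_diff tendsto_mult tendsto_const 2 tendsto_add tendsto_ident_at
        tendsto_poisson_cdf V)
  moreover have "eventually (\<lambda>\<delta>. f \<delta> \<le> prob (low_degree_event r)) (at_right 0)"
  proof -
    have "((\<lambda>\<delta>. 2 * (r + 2 * \<delta>) + \<delta>) \<longlongrightarrow> 2 * (r + 2 * 0) + 0) (at_right 0)"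
      by (intro tendsto_intros)
    then have e1: "eventually (\<lambda>\<delta>. 2 * (r + 2 * \<delta>) + \<delta> < 3/7) (at_right 0)"
      by (rule order_tendstoD) (use r in simp)
    have "((\<lambda>\<delta>. 2 * V \<delta>) \<longlongrightarrow> 2 * V 0) (at_right 0)"
      unfolding V_def by (intro tendsto_intros)
    then have e2: "eventually (\<lambda>\<delta>. 2 * V \<delta> < V (\<epsilon> * r / 3)) (at_right 0)"
      by (rule order_tendstoD) (use r \<epsilon> in \<open>simp add: V_def ball_vol_def zero_power\<close>)
    have e3: "eventually (\<lambda>\<delta>::real. 0 < \<delta>) (at_right 0)"
      by (rule eventually_at_right_less)
    show ?thesis
      using e1 e2 e3
    proof eventually_elim
      case (elim \<delta>)
      then show ?case
        unfolding f_def V_def by (intro low_degree_prob_lower_mesh r \<epsilon>) (auto simp: V_def)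
    qed
  qed
  ultimately have "t * (F (V r) - K * V 0)
       - C * t\<^sup>2 * (V (\<epsilon> * r + 0) * (of_bool (2 \<le> k) * poisson_cdf (k - 2) (t * V r))
         + V (2 * (r + 2 * 0) + 0)
             * (poisson_cdf (k - 1) (t * V r) * poisson_cdf (k - 1) (t * (V (\<epsilon> * r / 3) - 2 * V 0)))
         + (poisson_cdf (k - 1) (t * V r))\<^sup>2) \<le> prob (low_degree_event r)"
    by (rule tendsto_upperbound) (rule trivial_limit_at_right_real)
  then show ?thesis
    by (simp add: V_def ball_vol_0)
qed

end

section \<open>The Poisson process\<close>

text \<open>In the definition the independent counts are indexed by the sets themselves.  A family may
  repeat the empty set, so empty members are split off: their count is \<open>0\<close>, and the condition
  imposed on it holds everywhere.\<close>

lemma poisson_process_indep: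
  fixes N :: "'a \<Rightarrow> (real ^ 'd) multiset" and A :: "'i \<Rightarrow> (real ^ 'd) set"
  assumes pp: "poisson_process M N t" and I: "finite I" "disjoint_family_on A I"
    and A: "\<And>i. i \<in> I \<Longrightarrow> A i \<in> sets borel" "\<And>i. i \<in> I \<Longrightarrow> A i \<subseteq> unit_cube"
    and S: "\<And>i. i \<in> I \<Longrightarrow> A i = {} \<Longrightarrow> 0 \<in> S i"
  shows "measure M {w \<in> space M. \<forall>i\<in>I. num_points (N w) (A i) \<in> S i}
       = (\<Prod>i\<in>I. measure M {w \<in> space M. num_points (N w) (A i) \<in> S i})"
proof -
  interpret prob_space M
    using pp by (simp add: poisson_process_def)
  define J where "J = {i \<in> I. A i \<noteq> {}}"
  have J: "finite J" "J \<subseteq> I"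
    using I(1) by (auto simp: J_def)
  have full: "{w \<in> space M. num_points (N w) (A i) \<in> S i} = space M" if "i \<in> I - J" for i
    using that S by (auto simp: J_def)
  have inj: "inj_on A J"
  proof (rule inj_onI, rule ccontr)
    fix i j assume ij: "i \<in> J" "j \<in> J" "A i = A j" "i \<noteq> j"
    then have "A i \<inter> A j = {}"
      using I(2) J(2) by (intro disjoint_family_onD[OF I(2)]) auto
    with ij show False
      by (simp add: J_def)
  qed
  have "disjoint (A ` J)"
    using disjoint_family_on_mono[OF J(2) I(2)] by (rule disjoint_family_on_disjoint_image)
  moreover have "finite (A ` J)" "A ` J \<subseteq> sets borel" "\<Union>(A ` J) \<subseteq> unit_cube"
    using A J by (blast intro: finite_imageI)+
  moreover have "\<forall>F. finite F \<and> F \<subseteq> sets borel \<and> \<Union>F \<subseteq> unit_cube \<and> disjoint F \<longrightarrow>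
      indep_vars (\<lambda>_. count_space UNIV) (\<lambda>B w. num_points (N w) B) F"
    using pp by (simp add: poisson_process_def)
  ultimately have ind: "indep_vars (\<lambda>_. count_space UNIV) (\<lambda>B w. num_points (N w) B) (A ` J)"
    by blast
  have "{w \<in> space M. \<forall>i\<in>I. num_points (N w) (A i) \<in> S i} = {w \<in> space M. \<forall>i\<in>J. num_points (N w) (A i) \<in> S i}"
    using full J by blast
  also have "prob \<dots> = (\<Prod>i\<in>J. prob {w \<in> space M. num_points (N w) (A i) \<in> S i})"
  proof (cases "J = {}")
    case False
    have "{w \<in> space M. \<forall>i\<in>J. num_points (N w) (A i) \<in> S i}
        = (\<Inter>i\<in>J. (\<lambda>w. num_points (N w) (A i)) -` S i \<inter> space M)"
      using False by auto
    also have "\<dots> = (\<Inter>B\<in>A ` J. (\<lambda>w. num_points (N w) B) -` S (inv_into J A B) \<inter> space M)"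
      by (simp add: inv_into_f_f[OF inj])
    also have "prob \<dots> = (\<Prod>B\<in>A ` J. prob ((\<lambda>w. num_points (N w) B) -` S (inv_into J A B) \<inter> space M))"
      by (rule indep_varsD_finite[OF ind]) (use False J(1) in auto)
    also have "\<dots> = (\<Prod>i\<in>J. prob ((\<lambda>w. num_points (N w) (A i)) -` S i \<inter> space M))"
      by (simp add: prod.reindex[OF inj] inv_into_f_f[OF inj])
    also have "\<dots> = (\<Prod>i\<in>J. prob {w \<in> space M. num_points (N w) (A i) \<in> S i})"
      by (simp add: vimage_def Int_def conj_commute)
    finally show ?thesis .
  qed (simp add: prob_space)
  also have "\<dots> = (\<Prod>i\<in>I. prob {w \<in> space M. num_points (N w) (A i) \<in> S i})"
    using full by (intro prod.mono_neutral_left I(1) J(2)) (auto simp: prob_space)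
  finally show ?thesis .
qed

lemma poisson_process_estimates:
  fixes N :: "'a \<Rightarrow> (real ^ 'd) multiset"
  assumes pp: "poisson_process M N t" and t: "0 \<le> t" and k: "1 \<le> k"
  shows "palm_estimates M N t 1 t k (\<lambda>v. poisson_cdf (k - 1) (t * v))"
proof -
  interpret prob_space M
    using pp by (simp add: poisson_process_def)
  have in_cube: "set_mset (N w) \<subseteq> unit_cube" if "w \<in> space M" for w
    using pp that by (simp add: poisson_process_def)
  have pmf: "prob {w \<in> space M. num_points (N w) A = j} = (t * measure lborel A) ^ j / fact j * exp (- (t * measure lborel A))"
    if "A \<in> sets borel" "A \<subseteq> unit_cube" for A j
    using pp that by (simp add: poisson_process_def)
  have meas: "(\<lambda>w. num_points (N w) A) \<in> measurable M (count_space UNIV)" if "A \<in> sets borel" for A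
  proof -
    have "indep_vars (\<lambda>_. count_space UNIV) (\<lambda>B w. num_points (N w) B) {A \<inter> unit_cube}"
      using pp that by (auto simp: poisson_process_def)
    then have "(\<lambda>w. num_points (N w) (A \<inter> unit_cube)) \<in> measurable M (count_space UNIV)"
      by (auto simp: indep_vars_def)
    moreover have "num_points (N w) A = num_points (N w) (A \<inter> unit_cube)" if "w \<in> space M" for w
      unfolding num_points_def using in_cube[OF that] by (intro arg_cong[where f = size] filter_mset_cong) auto
    ultimately show ?thesis
      by (simp cong: measurable_cong)
  qed
  have ev: "{w \<in> space M. num_points (N w) A \<in> S} \<in> events" if "A \<in> sets borel" for A S
    using measurable_sets[OF meas[OF that], of S] by (simp add: vimage_def Int_def conj_commute)
  have cdf: "prob {w \<in> space M. num_points (N w) A \<in> {..m}} = poisson_cdf m (t * measure lborel A)"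
    if A: "A \<in> sets borel" "A \<subseteq> unit_cube" for A m
  proof -
    have "{w \<in> space M. num_points (N w) A \<in> {..m}} = (\<Union>j\<le>m. {w \<in> space M. num_points (N w) A \<in> {j}})"
      by auto
    also have "prob \<dots> = (\<Sum>j\<le>m. prob {w \<in> space M. num_points (N w) A \<in> {j}})"
    proof (rule finite_measure_finite_Union)
      show "(\<lambda>j. {w \<in> space M. num_points (N w) A \<in> {j}}) ` {..m} \<subseteq> events"
        using ev[OF A(1)] by blast
    qed (auto simp: disjoint_family_on_def)
    also have "\<dots> = poisson_cdf m (t * measure lborel A)"
      using pmf[OF A] by (simp add: poisson_cdf_def sum_distrib_right)
    finally show ?thesis .
  qed
  have pos: "prob {w \<in> space M. num_points (N w) A \<in> {1..}} \<le> t * measure lborel A"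
    if A: "A \<in> sets borel" "A \<subseteq> unit_cube" for A
  proof -
    have "{w \<in> space M. num_points (N w) A \<in> {1..}} = space M - {w \<in> space M. num_points (N w) A \<in> {0}}"
      by auto
    also have "prob \<dots> = 1 - exp (- (t * measure lborel A))"
      using ev[OF A(1), of "{0}"] pmf[OF A, of 0] by (simp add: prob_compl)
    also have "\<dots> \<le> t * measure lborel A"
      using exp_ge_add_one_self[of "- (t * measure lborel A)"] by simp
    finally show ?thesis .
  qed
  show ?thesis
  proof unfold_locales
    show "(\<lambda>w. num_points (N w) A) \<in> measurable M (count_space UNIV)" if "A \<in> sets borel" for A
      using meas[OF that] .
    show "AE w in M. set_mset (N w) \<subseteq> unit_cube"
      by (rule AE_I2) (rule in_cube)
    show "0 \<le> t" "0 \<le> (1::real)" "1 \<le> k"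
      using t k by auto
  next
    fix Q B :: "(real ^ 'd) set"
    assume *: "Q \<in> sets borel" "B \<in> sets borel" "Q \<subseteq> unit_cube" "B \<subseteq> unit_cube" "Q \<inter> B = {}"
    show "prob {w \<in> space M. 1 \<le> num_points (N w) Q \<and> num_points (N w) B \<le> k - 1}
        \<le> t * measure lborel Q * poisson_cdf (k - 1) (t * measure lborel B)"
    proof (cases "Q = {}")
      case False
      let ?A = "\<lambda>b. if b then Q else B" and ?S = "\<lambda>b. if b then {1..} else {..k - 1}"
      have "{w \<in> space M. 1 \<le> num_points (N w) Q \<and> num_points (N w) B \<le> k - 1}
          = {w \<in> space M. \<forall>b\<in>UNIV. num_points (N w) (?A b) \<in> ?S b}"
        by (auto simp: UNIV_bool)
      also have "prob \<dots> = (\<Prod>b\<in>UNIV. prob {w \<in> space M. num_points (N w) (?A b) \<in> ?S b})"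
        using * False by (intro poisson_process_indep[OF pp]) (auto simp: disjoint_family_on_def)
      also have "\<dots> = prob {w \<in> space M. num_points (N w) Q \<in> {1..}} * prob {w \<in> space M. num_points (N w) B \<in> {..k - 1}}"
        unfolding UNIV_bool by simp
      also have "\<dots> \<le> t * measure lborel Q * poisson_cdf (k - 1) (t * measure lborel B)"
        unfolding cdf[OF *(2,4)] using pos[OF *(1,3)] t
        by (intro mult_right_mono poisson_cdf_nonneg) auto
      finally show ?thesis .
    qed simp
  next
    fix Q B :: "(real ^ 'd) set"
    assume *: "Q \<in> sets borel" "B \<in> sets borel" "Q \<subseteq> B" "B \<subseteq> unit_cube"
    let ?x = "t * measure lborel Q" and ?y = "t * measure lborel B"
    show "t * measure lborel Q * (poisson_cdf (k - 1) ?y - t * measure lborel Q)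
        \<le> prob {w \<in> space M. 1 \<le> num_points (N w) Q \<and> num_points (N w) B \<le> k}"
    proof (cases "Q = {}")
      case False
      have Qc: "Q \<subseteq> unit_cube"
        using * by auto
      have nn: "0 \<le> ?x" "0 \<le> ?y" "0 \<le> t * measure lborel (B - Q)"
        using t by auto
      have "t * measure lborel (B - Q) \<le> ?y"
        using * t by (intro mult_left_mono vol_mono_in_cube) auto
      then have BQ: "poisson_cdf (k - 1) ?y \<le> poisson_cdf (k - 1) (t * measure lborel (B - Q))"
        using nn by (intro poisson_cdf_antimono) auto
      have e: "1 - ?x \<le> exp (- ?x)"
        using exp_ge_add_one_self[of "- ?x"] by simp
      have "poisson_cdf (k - 1) ?y - ?x \<le> poisson_cdf (k - 1) ?y - ?x * poisson_cdf (k - 1) ?y"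
        using nn poisson_cdf_le_1[OF nn(2), of "k - 1"] by (simp add: mult_left_le)
      also have "\<dots> = (1 - ?x) * poisson_cdf (k - 1) ?y"
        by (simp add: algebra_simps)
      also have "\<dots> \<le> exp (- ?x) * poisson_cdf (k - 1) ?y"
        using e nn by (intro mult_right_mono poisson_cdf_nonneg) auto
      also have "\<dots> \<le> exp (- ?x) * poisson_cdf (k - 1) (t * measure lborel (B - Q))"
        using BQ by (intro mult_left_mono) auto
      finally have "?x * (poisson_cdf (k - 1) ?y - ?x)
          \<le> ?x * (exp (- ?x) * poisson_cdf (k - 1) (t * measure lborel (B - Q)))"
        using nn(1) by (rule mult_left_mono)
      also have "\<dots> = prob {w \<in> space M. num_points (N w) Q \<in> {1}} * prob {w \<in> space M. num_points (N w) (B - Q) \<in> {..k - 1}}"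
      proof -
        have "B - Q \<in> sets borel" "B - Q \<subseteq> unit_cube"
          using * by auto
        then show ?thesis
          using pmf[OF *(1) Qc, of 1] cdf[of "B - Q" "k - 1"] by simp
      qed
      also have "\<dots> = prob {w \<in> space M. \<forall>b\<in>UNIV. num_points (N w) (if b then Q else B - Q) \<in> (if b then {1} else {..k - 1})}"
        using * False Qc by (subst poisson_process_indep[OF pp]) (auto simp: disjoint_family_on_def UNIV_bool)
      also have "\<dots> \<le> prob {w \<in> space M. 1 \<le> num_points (N w) Q \<and> num_points (N w) B \<le> k}"
      proof (rule finite_measure_mono)
        have "num_points (N w) B = num_points (N w) Q + num_points (N w) (B - Q)" for w
          using num_points_Un_disjoint[of Q "B - Q" "N w"] * by (simp add: Un_absorb1)
        then show "{w \<in> space M. \<forall>b\<in>UNIV. num_points (N w) (if b then Q else B - Q) \<in> (if b then {1} else {..k - 1})}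
            \<subseteq> {w \<in> space M. 1 \<le> num_points (N w) Q \<and> num_points (N w) B \<le> k}"
          using k by (auto simp: UNIV_bool)
        show "{w \<in> space M. 1 \<le> num_points (N w) Q \<and> num_points (N w) B \<le> k} \<in> events"
          using ev[of Q "{1..}"] ev[of B "{..k}"] * by (intro sets.sets_Collect_conj) auto
      qed
      finally show ?thesis .
    qed simp
  next
    fix Q Q' B D :: "(real ^ 'd) set" and m m' :: nat
    assume *: "Q \<in> sets borel" "Q' \<in> sets borel" "B \<in> sets borel" "D \<in> sets borel"
      "Q \<subseteq> unit_cube" "Q' \<subseteq> unit_cube" "B \<subseteq> unit_cube" "D \<subseteq> unit_cube"
      "Q \<inter> Q' = {}" "Q \<inter> B = {}" "Q \<inter> D = {}" "Q' \<inter> B = {}" "Q' \<inter> D = {}" "B \<inter> D = {}" "m \<le> k" "m' \<le> k"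
    show "prob {w \<in> space M. 1 \<le> num_points (N w) Q \<and> 1 \<le> num_points (N w) Q'
               \<and> num_points (N w) B \<le> m \<and> num_points (N w) D \<le> m'}
        \<le> 1 * t\<^sup>2 * measure lborel Q * measure lborel Q'
          * poisson_cdf m (t * measure lborel B) * poisson_cdf m' (t * measure lborel D)"
    proof (cases "Q = {} \<or> Q' = {}")
      case False
      let ?A = "\<lambda>(b, c). if b then (if c then Q else Q') else (if c then B else D)"
      let ?S = "\<lambda>(b, c). if b then {1..} else {..if c then m else m'}"
      have U: "(UNIV :: (bool \<times> bool) set) = {(True, True), (True, False), (False, True), (False, False)}"
        by auto
      have "{w \<in> space M. 1 \<le> num_points (N w) Q \<and> 1 \<le> num_points (N w) Q'
               \<and> num_points (N w) B \<le> m \<and> num_points (N w) D \<le> m'}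
          = {w \<in> space M. \<forall>b\<in>UNIV. num_points (N w) (?A b) \<in> ?S b}"
        by (auto simp: U)
      also have "prob \<dots> = (\<Prod>b\<in>UNIV. prob {w \<in> space M. num_points (N w) (?A b) \<in> ?S b})"
        using * False by (intro poisson_process_indep[OF pp]) (auto simp: disjoint_family_on_def split: if_splits)
      also have "\<dots> = prob {w \<in> space M. num_points (N w) Q \<in> {1..}} * (prob {w \<in> space M. num_points (N w) Q' \<in> {1..}}
          * (prob {w \<in> space M. num_points (N w) B \<in> {..m}} * prob {w \<in> space M. num_points (N w) D \<in> {..m'}}))"
        unfolding U by simp
      also have "\<dots> \<le> (t * measure lborel Q) * ((t * measure lborel Q') *
          (poisson_cdf m (t * measure lborel B) * poisson_cdf m' (t * measure lborel D)))"
        unfolding cdf[OF *(3,7)] cdf[OF *(4,8)] using pos[OF *(1,5)] pos[OF *(2,6)] t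
        by (intro mult_mono mult_right_mono mult_nonneg_nonneg poisson_cdf_nonneg) auto
      finally show ?thesis
        by (simp add: power2_eq_square algebra_simps)
    qed auto
  qed
qed

section \<open>The binomial process\<close>

definition binomial_cdf :: "nat \<Rightarrow> nat \<Rightarrow> real \<Rightarrow> real" where
  "binomial_cdf n m v = (\<Sum>i\<le>m. real (n choose i) * (v ^ i * (1 - v) ^ (n - i)))"

lemma isCont_binomial_cdf: "isCont (binomial_cdf n m) v"
  unfolding binomial_cdf_def by (intro continuous_intros)

lemma num_points_binomial_process:
  "num_points (binomial_process X n w) A = card {i \<in> {1..n}. X i w \<in> A}"
  unfolding num_points_def binomial_process_def
  by (simp add: filter_mset_image_mset filter_mset_mset_set)

lemma sum_over_small_subsets:
  fixes g :: "nat \<Rightarrow> real"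
  assumes "finite R"
  shows "(\<Sum>S | S \<subseteq> R \<and> card S \<le> m. g (card S)) = (\<Sum>i\<le>m. real (card R choose i) * g i)"
proof -
  have fin: "finite {S. S \<subseteq> R \<and> card S \<le> m}"
    using assms by simp
  have "(\<Sum>S | S \<subseteq> R \<and> card S \<le> m. g (card S))
      = (\<Sum>i\<le>m. \<Sum>S\<in>{S \<in> {S. S \<subseteq> R \<and> card S \<le> m}. card S = i}. g (card S))"
    by (rule sum.group[symmetric]) (use fin in auto)
  also have "\<dots> = (\<Sum>i\<le>m. real (card R choose i) * g i)"
  proof (rule sum.cong[OF refl])
    fix i assume "i \<in> {..m}"
    then have "{S \<in> {S. S \<subseteq> R \<and> card S \<le> m}. card S = i} = {S. S \<subseteq> R \<and> card S = i}"
      by auto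
    then show "(\<Sum>S\<in>{S \<in> {S. S \<subseteq> R \<and> card S \<le> m}. card S = i}. g (card S)) = real (card R choose i) * g i"
      using n_subsets[OF assms, of i] by simp
  qed
  finally show ?thesis .
qed

lemma iid_uniform_prob:
  fixes X :: "nat \<Rightarrow> 'a \<Rightarrow> real ^ 'd"
  assumes X: "iid_uniform M X" and A: "\<And>i. i \<in> {1..n} \<Longrightarrow> A i \<in> sets borel"
  shows "measure M {w \<in> space M. \<forall>i\<in>{1..n}. X i w \<in> A i} = (\<Prod>i\<in>{1..n}. measure lborel (unit_cube \<inter> A i))"
proof -
  interpret prob_space M
    using X by (simp add: iid_uniform_def)
  have ind: "indep_vars (\<lambda>_. borel) X {1..}"
    using X by (simp add: iid_uniform_def)
  have single: "prob (X i -` A i \<inter> space M) = measure lborel (unit_cube \<inter> A i)" if i: "i \<in> {1..n}" for i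
  proof -
    have "X i \<in> borel_measurable M"
      using ind i by (auto simp: indep_vars_def)
    then have "prob (X i -` A i \<inter> space M) = measure (distr M borel (X i)) (A i)"
      using A[OF i] by (simp add: measure_distr)
    also have "\<dots> = measure (uniform_measure lborel unit_cube) (A i)"
      using X i by (simp add: iid_uniform_def)
    also have "\<dots> = measure lborel (unit_cube \<inter> A i) / measure lborel (unit_cube :: (real ^ 'd) set)"
      using A[OF i] by (intro measure_uniform_measure) (auto simp: emeasure_unit_cube)
    finally show ?thesis
      by (simp add: measure_unit_cube)
  qed
  show ?thesis
  proof (cases "n = 0")
    case False
    have "{w \<in> space M. \<forall>i\<in>{1..n}. X i w \<in> A i} = (\<Inter>i\<in>{1..n}. X i -` A i \<inter> space M)"
      using False by auto
    also have "prob \<dots> = (\<Prod>i\<in>{1..n}. prob (X i -` A i \<inter> space M))"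
      using False A by (intro indep_varsD[OF ind]) auto
    finally show ?thesis
      using single by simp
  qed (simp add: prob_space)
qed

lemma vol_compl_in_cube:
  fixes B :: "(real ^ 'd) set"
  assumes "B \<in> sets borel" "B \<subseteq> unit_cube"
  shows "measure lborel (unit_cube \<inter> - B) = 1 - measure lborel B"
proof -
  have "measure lborel (unit_cube - B) = measure lborel (unit_cube :: (real ^ 'd) set) - measure lborel B"
    using assms by (intro measurable_measure_Diff) (auto intro: fmeasurable_in_cube)
  then show ?thesis
    by (simp add: measure_unit_cube Diff_eq)
qed

text \<open>The event records one point in \<open>Q\<close> and exactly which other points lie in \<open>B\<close>; sums over \<open>a\<close> and
  \<open>S\<close> then give the one-point estimates.  The upper estimate uses \<open>B' = B\<close>; the lower one uses the pair \<open>B - Q\<close>, \<open>B\<close>, which makes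
  \<open>a\<close> the only point in \<open>Q\<close>.\<close>

lemma iid_uniform_prob_pattern:
  fixes X :: "nat \<Rightarrow> 'a \<Rightarrow> real ^ 'd"
  assumes X: "iid_uniform M X" and a: "a \<in> {1..n}" and S: "S \<subseteq> {1..n} - {a}"
    and Q: "Q \<in> sets borel" "Q \<subseteq> unit_cube" and B: "B \<in> sets borel" "B \<subseteq> unit_cube"
    and B': "B' \<in> sets borel" "B' \<subseteq> unit_cube"
  shows "measure M {w \<in> space M. X a w \<in> Q \<and> (\<forall>i\<in>S. X i w \<in> B) \<and> (\<forall>i\<in>{1..n} - {a} - S. X i w \<notin> B')}
       = measure lborel Q * (measure lborel B ^ card S * (1 - measure lborel B') ^ (n - 1 - card S))"
proof -
  let ?A = "\<lambda>i. if i = a then Q else if i \<in> S then B else - B'"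
  have "{w \<in> space M. X a w \<in> Q \<and> (\<forall>i\<in>S. X i w \<in> B) \<and> (\<forall>i\<in>{1..n} - {a} - S. X i w \<notin> B')}
      = {w \<in> space M. \<forall>i\<in>{1..n}. X i w \<in> ?A i}"
    using a S by (intro Collect_cong conj_cong refl) (auto split: if_splits)
  also have "measure M \<dots> = (\<Prod>i\<in>{1..n}. measure lborel (unit_cube \<inter> ?A i))"
    using Q B B' by (intro iid_uniform_prob[OF X]) auto
  also have "\<dots> = measure lborel (unit_cube \<inter> ?A a) * (\<Prod>i\<in>{1..n} - {a}. measure lborel (unit_cube \<inter> ?A i))"
    using a by (intro prod.remove) auto
  also have "(\<Prod>i\<in>{1..n} - {a}. measure lborel (unit_cube \<inter> ?A i))
      = (\<Prod>i\<in>{1..n} - {a}. if i \<in> S then measure lborel B else 1 - measure lborel B')"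
    using Q B B' by (intro prod.cong) (auto simp: vol_compl_in_cube Int_absorb1)
  also have "\<dots> = measure lborel B ^ card S * (1 - measure lborel B') ^ card ({1..n} - {a} - S)"
    using S by (subst prod.If_cases) (auto simp: Int_absorb1 Collect_conj_eq Diff_eq)
  also have "card ({1..n} - {a} - S) = n - 1 - card S"
    using a S finite_subset[OF S] by (simp add: card_Diff_subset)
  finally show ?thesis
    using Q by (simp add: Int_absorb1)
qed

lemma choose_le_power_div_fact:
  assumes "N \<le> n"
  shows "real (N choose i) \<le> real n ^ i / fact i"
proof -
  have "(N choose i) * fact i \<le> N ^ i"
    by (rule binomial_fact_pow)
  also have "N ^ i \<le> n ^ i"
    using assms by (rule power_mono) simp
  finally have "real ((N choose i) * fact i) \<le> real (n ^ i)"
    by (rule of_nat_mono)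
  then show ?thesis
    by (simp add: field_simps)
qed

lemma sum_small_subsets_le:
  fixes v :: real
  assumes "0 \<le> v"
  shows "(\<Sum>S | S \<subseteq> {1..n} \<and> card S \<le> m. v ^ card S) \<le> (\<Sum>i\<le>m. (real n * v) ^ i / fact i)"
proof -
  have "(\<Sum>S | S \<subseteq> {1..n} \<and> card S \<le> m. v ^ card S) = (\<Sum>i\<le>m. real (n choose i) * v ^ i)"
    using sum_over_small_subsets[where R = "{1..n}" and g = "\<lambda>i. v ^ i" and m = m] by simp
  also have "\<dots> \<le> (\<Sum>i\<le>m. (real n * v) ^ i / fact i)"
  proof (rule sum_mono)
    fix i
    have "real (n choose i) * v ^ i \<le> real n ^ i / fact i * v ^ i"
      using assms choose_le_power_div_fact[of n n i] by (intro mult_right_mono) auto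
    then show "real (n choose i) * v ^ i \<le> (real n * v) ^ i / fact i"
      by (simp add: power_mult_distrib)
  qed
  finally show ?thesis .
qed

text \<open>At least \<open>n - 2 - 2k\<close> points avoid \<open>B \<union> D\<close>, and \<open>1 - v \<le> e\<^sup>-\<^sup>v\<close>.  Replacing that exponent by \<open>n\<close> costs
  the constant factor, as \<open>B \<union> D\<close> has volume at most \<open>1\<close>.  For overlapping index sets the event is empty,
  so they can be kept in a union bound.\<close>

lemma iid_uniform_prob_two_points:
  fixes X :: "nat \<Rightarrow> 'a \<Rightarrow> real ^ 'd"
  assumes X: "iid_uniform M X" and ac: "a \<in> {1..n}" "c \<in> {1..n}"
    and S: "S \<subseteq> {1..n}" "card S \<le> k" "S' \<subseteq> {1..n}" "card S' \<le> k"
    and Q: "Q \<in> sets borel" "Q \<subseteq> unit_cube" and Q': "Q' \<in> sets borel" "Q' \<subseteq> unit_cube"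
    and B: "B \<in> sets borel" "B \<subseteq> unit_cube" and D: "D \<in> sets borel" "D \<subseteq> unit_cube"
    and disj: "Q \<inter> Q' = {}" "Q \<inter> B = {}" "Q \<inter> D = {}" "Q' \<inter> B = {}" "Q' \<inter> D = {}" "B \<inter> D = {}"
  shows "measure M {w \<in> space M. X a w \<in> Q \<and> X c w \<in> Q' \<and> (\<forall>i\<in>S. X i w \<in> B) \<and> (\<forall>i\<in>S'. X i w \<in> D)
            \<and> (\<forall>i\<in>{1..n} - ({a, c} \<union> S \<union> S'). X i w \<notin> B \<union> D)}
       \<le> measure lborel Q * measure lborel Q' * (measure lborel B ^ card S * measure lborel D ^ card S')
          * (exp (2 * real k + 2) * exp (- real n * (measure lborel B + measure lborel D)))"
    (is "measure M ?E \<le> ?R")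
proof (cases "a \<noteq> c \<and> a \<notin> S \<and> c \<notin> S \<and> a \<notin> S' \<and> c \<notin> S' \<and> S \<inter> S' = {}")
  case False
  have "False" if w: "w \<in> ?E" for w
  proof -
    have 1: "X a w \<in> Q" "X c w \<in> Q'" and 2: "\<And>i. i \<in> S \<Longrightarrow> X i w \<in> B" "\<And>i. i \<in> S' \<Longrightarrow> X i w \<in> D"
      using w by auto
    consider "a = c" | "a \<in> S" | "c \<in> S" | "a \<in> S'" | "c \<in> S'" | i where "i \<in> S" "i \<in> S'"
      using False by blast
    then show False
      by cases (metis 1 2 disj disjoint_iff)+
  qed
  then have empty: "?E = {}"
    by blast
  show ?thesis
    unfolding empty by simp
next
  case True
  let ?b = "measure lborel B" and ?d = "measure lborel D"
  let ?R = "{1..n} - ({a, c} \<union> S \<union> S')"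
  let ?A = "\<lambda>i. if i = a then Q else if i = c then Q' else if i \<in> S then B else if i \<in> S' then D else - (B \<union> D)"
  have fin: "finite S" "finite S'"
    using finite_subset[OF S(1)] finite_subset[OF S(3)] by simp_all
  have BD: "measure lborel (B \<union> D) = ?b + ?d"
    using measure_Un3[OF fmeasurable_in_cube[OF B] fmeasurable_in_cube[OF D]] disj by simp
  have BD1: "?b + ?d \<le> 1"
    using vol_le_1[of "B \<union> D"] B D by (simp add: BD)
  have split: "prod g {1..n} = g a * (g c * (prod g S * (prod g S' * prod g ?R)))" for g :: "nat \<Rightarrow> real"
  proof -
    have "prod g (S' \<union> ?R) = prod g S' * prod g ?R"
      by (rule prod.union_disjoint) (use fin in auto)
    moreover have "prod g (S \<union> (S' \<union> ?R)) = prod g S * prod g (S' \<union> ?R)"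
      by (rule prod.union_disjoint) (use fin True in auto)
    moreover have "prod g (insert c (S \<union> (S' \<union> ?R))) = g c * prod g (S \<union> (S' \<union> ?R))"
      by (rule prod.insert) (use fin True in auto)
    moreover have "prod g (insert a (insert c (S \<union> (S' \<union> ?R)))) = g a * prod g (insert c (S \<union> (S' \<union> ?R)))"
      by (rule prod.insert) (use fin True in auto)
    moreover have "{1..n} = insert a (insert c (S \<union> (S' \<union> ?R)))"
      using ac S by auto
    ultimately show ?thesis
      by simp
  qed
  have "?E = {w \<in> space M. \<forall>i\<in>{1..n}. X i w \<in> ?A i}"
    using ac S True by (intro Collect_cong conj_cong refl) (auto split: if_splits)
  also have "measure M \<dots> = (\<Prod>i\<in>{1..n}. measure lborel (unit_cube \<inter> ?A i))"
    using Q Q' B D by (intro iid_uniform_prob[OF X]) auto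
  also have "\<dots> = measure lborel (unit_cube \<inter> ?A a) * (measure lborel (unit_cube \<inter> ?A c)
      * ((\<Prod>i\<in>S. measure lborel (unit_cube \<inter> ?A i)) * ((\<Prod>i\<in>S'. measure lborel (unit_cube \<inter> ?A i))
      * (\<Prod>i\<in>?R. measure lborel (unit_cube \<inter> ?A i)))))"
    by (rule split)
  also have "measure lborel (unit_cube \<inter> ?A a) = measure lborel Q"
    using Q by (simp add: Int_absorb1)
  also have "measure lborel (unit_cube \<inter> ?A c) = measure lborel Q'"
    using Q' True by (simp add: Int_absorb1)
  also have "(\<Prod>i\<in>S. measure lborel (unit_cube \<inter> ?A i)) = (\<Prod>i\<in>S. ?b)"
    using B True by (intro prod.cong) (auto simp: Int_absorb1)
  also have "(\<Prod>i\<in>S'. measure lborel (unit_cube \<inter> ?A i)) = (\<Prod>i\<in>S'. ?d)"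
    using D True by (intro prod.cong) (auto simp: Int_absorb1)
  also have "(\<Prod>i\<in>?R. measure lborel (unit_cube \<inter> ?A i)) = (\<Prod>i\<in>?R. 1 - (?b + ?d))"
    using B D vol_compl_in_cube[of "B \<union> D"] BD by (intro prod.cong) auto
  also have "\<dots> = (1 - (?b + ?d)) ^ card ?R"
    by simp
  finally have E: "measure M ?E = measure lborel Q * measure lborel Q' * (?b ^ card S * ?d ^ card S') * (1 - (?b + ?d)) ^ card ?R"
    by simp
  have "(1 - (?b + ?d)) ^ card ?R \<le> exp (- (?b + ?d)) ^ card ?R"
  proof (rule power_mono)
    show "1 - (?b + ?d) \<le> exp (- (?b + ?d))"
      using exp_ge_add_one_self[of "- (?b + ?d)"] by linarith
  qed (use BD1 in simp)
  also have "\<dots> = exp (- (real (card ?R) * (?b + ?d)))"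
    unfolding exp_of_nat_mult[symmetric] by (simp add: algebra_simps)
  also have "\<dots> \<le> exp ((2 * real k + 2) + - real n * (?b + ?d))"
  proof -
    have "n \<le> card ?R + card ({a, c} \<union> S \<union> S')"
    proof -
      have "?R \<union> ({a, c} \<union> S \<union> S') = {1..n}"
        using ac S by auto
      then show ?thesis
        using card_Un_le[of ?R "{a, c} \<union> S \<union> S'"] by simp
    qed
    also have "card ({a, c} \<union> S \<union> S') \<le> card {a, c} + card S + card S'"
      using card_Un_le[of "{a, c} \<union> S" S'] card_Un_le[of "{a, c}" S] by linarith
    also have "\<dots> \<le> 2 * k + 2"
      using S True by simp
    finally have "real n - real (card ?R) \<le> 2 * real k + 2"
      by simp
    then have "(real n - real (card ?R)) * (?b + ?d) \<le> (2 * real k + 2) * 1"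
      using BD1 by (intro order_trans[OF mult_right_mono mult_left_mono]) auto
    then show ?thesis
      by (simp add: algebra_simps)
  qed
  also have "\<dots> = exp (2 * real k + 2) * exp (- real n * (?b + ?d))"
    by (rule exp_add)
  finally show ?thesis
    unfolding E by (intro mult_left_mono) auto
qed

text \<open>The pattern \<open>(a, S)\<close> can be read off from the points, so distinct patterns are disjoint events and
  their probabilities add up to a lower bound.\<close>

lemma pattern_unique:
  assumes "Q \<subseteq> B" "a \<in> I" "S \<subseteq> I - {a}"
    and "x a \<in> Q" "\<forall>i\<in>S. x i \<in> B - Q" "\<forall>i\<in>I - {a} - S. x i \<notin> B"
  shows "{i \<in> I. x i \<in> Q} = {a}" "{i \<in> I. x i \<in> B - Q} = S"
proof -
  have other: "x i \<notin> Q \<and> (x i \<in> B - Q \<longleftrightarrow> i \<in> S)" if "i \<in> I" "i \<noteq> a" for i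
    using that assms by (cases "i \<in> S") auto
  show "{i \<in> I. x i \<in> Q} = {a}"
    using other assms(2,4) by auto
  show "{i \<in> I. x i \<in> B - Q} = S"
    using other assms(3,4) by auto
qed

lemma binomial_process_estimates:
  fixes X :: "nat \<Rightarrow> 'a \<Rightarrow> real ^ 'd"
  assumes X: "iid_uniform M X" and k: "1 \<le> k"
  shows "palm_estimates M (binomial_process X n) (real n) (exp (2 * real k + 2))
           (\<Sum>i\<le>k - 1. real ((n - 1) choose i) * real i) k (binomial_cdf (n - 1) (k - 1))"
proof -
  interpret prob_space M
    using X by (simp add: iid_uniform_def)
  have meas [measurable]: "X i \<in> borel_measurable M" if "i \<in> {1..n}" for i
    using X that by (auto simp: iid_uniform_def indep_vars_def)
  have Xev: "{w \<in> space M. X i w \<in> A} \<in> events" if "i \<in> {1..n}" "A \<in> sets borel" for i A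
    using measurable_sets[OF meas[OF that(1)] that(2)] by (simp add: vimage_def Int_def conj_commute)
  have all_ev: "{w \<in> space M. \<forall>i\<in>I. X i w \<in> A} \<in> events" if "I \<subseteq> {1..n}" "A \<in> sets borel" for I A
    using that(1) Xev[OF _ that(2)] finite_subset[OF that(1)] by (intro sets.sets_Collect_finite_All) auto
  have counts: "(\<lambda>w. num_points (binomial_process X n w) A) \<in> measurable M (count_space UNIV)" if A: "A \<in> sets borel" for A
  proof -
    have [measurable]: "(\<lambda>w. if X i w \<in> A then 1 else 0 :: nat) \<in> measurable M (count_space UNIV)"
      if "i \<in> {1..n}" for i
      using Xev[OF that A] by (intro measurable_If) auto
    have "(\<lambda>w. \<Sum>i\<in>{1..n}. if X i w \<in> A then 1 else 0 :: nat) \<in> measurable M (count_space UNIV)"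
      by measurable
    moreover have "num_points (binomial_process X n w) A = (\<Sum>i\<in>{1..n}. if X i w \<in> A then 1 else 0)" for w
      unfolding num_points_binomial_process by (simp add: sum.If_cases Int_def)
    ultimately show ?thesis
      by simp
  qed
  have count_ev: "{w \<in> space M. m \<le> num_points (binomial_process X n w) A} \<in> events"
      "{w \<in> space M. num_points (binomial_process X n w) A \<le> m} \<in> events" if "A \<in> sets borel" for A m
    using counts[OF that] by measurable
  have pos: "1 \<le> num_points (binomial_process X n w) A \<longleftrightarrow> (\<exists>i\<in>{1..n}. X i w \<in> A)" for w A
    unfolding num_points_ge_1_iff by (auto simp: binomial_process_def)
  have small: "card {i \<in> I. X i w \<in> A} \<le> num_points (binomial_process X n w) A" if "I \<subseteq> {1..n}" for I w A
    unfolding num_points_binomial_process using that by (intro card_mono) auto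
  show ?thesis
  proof unfold_locales
    show "(\<lambda>w. num_points (binomial_process X n w) A) \<in> measurable M (count_space UNIV)" if "A \<in> sets borel" for A
      using counts[OF that] .
    have "prob {w \<in> space M. \<forall>i\<in>{1..n}. X i w \<in> unit_cube} = 1"
      by (subst iid_uniform_prob[OF X]) (auto simp: measure_unit_cube)
    then have "AE w in M. \<forall>i\<in>{1..n}. X i w \<in> unit_cube"
      using all_ev[of "{1..n}" unit_cube] by (subst (asm) prob_Collect_eq_1) auto
    then show "AE w in M. set_mset (binomial_process X n w) \<subseteq> unit_cube"
      by eventually_elim (auto simp: binomial_process_def)
    show "0 \<le> real n" "0 \<le> exp (2 * real k + 2)" "0 \<le> (\<Sum>i\<le>k - 1. real ((n - 1) choose i) * real i)" "1 \<le> k"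
      using k by (auto intro: sum_nonneg)
  next
    fix Q B :: "(real ^ 'd) set"
    assume *: "Q \<in> sets borel" "B \<in> sets borel" "Q \<subseteq> unit_cube" "B \<subseteq> unit_cube" "Q \<inter> B = {}"
    let ?E = "\<lambda>(a, S). {w \<in> space M. X a w \<in> Q \<and> (\<forall>i\<in>S. X i w \<in> B) \<and> (\<forall>i\<in>{1..n} - {a} - S. X i w \<notin> B)}"
    let ?Z = "SIGMA a:{1..n}. {S. S \<subseteq> {1..n} - {a} \<and> card S \<le> k - 1}"
    have ev: "?E z \<in> events" if "z \<in> ?Z" for z
      using that Xev[OF _ *(1)] all_ev[OF _ *(2)] all_ev[of _ "- B"] *(2)
      by (auto intro!: sets.sets_Collect_conj)
    have "prob {w \<in> space M. 1 \<le> num_points (binomial_process X n w) Q \<and> num_points (binomial_process X n w) B \<le> k - 1}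
        \<le> prob (\<Union>z\<in>?Z. ?E z)"
    proof (rule finite_measure_mono)
      show "{w \<in> space M. 1 \<le> num_points (binomial_process X n w) Q \<and> num_points (binomial_process X n w) B \<le> k - 1}
          \<subseteq> (\<Union>z\<in>?Z. ?E z)"
      proof
        fix w assume "w \<in> {w \<in> space M. 1 \<le> num_points (binomial_process X n w) Q
            \<and> num_points (binomial_process X n w) B \<le> k - 1}"
        then obtain a where w: "w \<in> space M" "num_points (binomial_process X n w) B \<le> k - 1"
          and a: "a \<in> {1..n}" "X a w \<in> Q"
          unfolding pos by blast
        have "(a, {i \<in> {1..n} - {a}. X i w \<in> B}) \<in> ?Z"
          using a small[of "{1..n} - {a}" w B] w(2) by auto
        moreover have "w \<in> ?E (a, {i \<in> {1..n} - {a}. X i w \<in> B})"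
          using w(1) a by auto
        ultimately show "w \<in> (\<Union>z\<in>?Z. ?E z)"
          by (rule UN_I)
      qed
      show "(\<Union>z\<in>?Z. ?E z) \<in> events"
        using ev by (intro sets.finite_UN) auto
    qed
    also have "\<dots> \<le> (\<Sum>z\<in>?Z. prob (?E z))"
      using ev by (intro finite_measure_subadditive_finite) auto
    also have "\<dots> = (\<Sum>a\<in>{1..n}. \<Sum>S | S \<subseteq> {1..n} - {a} \<and> card S \<le> k - 1. prob (?E (a, S)))"
      by (subst sum.Sigma) (auto intro!: sum.cong)
    also have "\<dots> = (\<Sum>a\<in>{1..n}. \<Sum>S | S \<subseteq> {1..n} - {a} \<and> card S \<le> k - 1.
        measure lborel Q * (measure lborel B ^ card S * (1 - measure lborel B) ^ (n - 1 - card S)))"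
    proof (intro sum.cong refl)
      fix a S assume "a \<in> {1..n}" "S \<in> {S. S \<subseteq> {1..n} - {a} \<and> card S \<le> k - 1}"
      then show "prob (?E (a, S)) = measure lborel Q * (measure lborel B ^ card S * (1 - measure lborel B) ^ (n - 1 - card S))"
        unfolding prod.case using * by (intro iid_uniform_prob_pattern[OF X]) auto
    qed
    also have "\<dots> = (\<Sum>a\<in>{1..n}. measure lborel Q * binomial_cdf (n - 1) (k - 1) (measure lborel B))"
    proof (rule sum.cong[OF refl])
      fix a assume "a \<in> {1..n}"
      then show "(\<Sum>S | S \<subseteq> {1..n} - {a} \<and> card S \<le> k - 1.
          measure lborel Q * (measure lborel B ^ card S * (1 - measure lborel B) ^ (n - 1 - card S)))
        = measure lborel Q * binomial_cdf (n - 1) (k - 1) (measure lborel B)"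
        unfolding sum_distrib_left[symmetric] binomial_cdf_def
        by (subst sum_over_small_subsets) auto
    qed
    also have "\<dots> = real n * measure lborel Q * binomial_cdf (n - 1) (k - 1) (measure lborel B)"
      by simp
    finally show "prob {w \<in> space M. 1 \<le> num_points (binomial_process X n w) Q \<and> num_points (binomial_process X n w) B \<le> k - 1}
        \<le> real n * measure lborel Q * binomial_cdf (n - 1) (k - 1) (measure lborel B)" .
  next
    fix Q B :: "(real ^ 'd) set"
    assume *: "Q \<in> sets borel" "B \<in> sets borel" "Q \<subseteq> B" "B \<subseteq> unit_cube"
    let ?K = "\<Sum>i\<le>k - 1. real ((n - 1) choose i) * real i"
    let ?q = "measure lborel Q" and ?b = "measure lborel B" and ?c = "measure lborel (B - Q)"
    have Qc: "Q \<subseteq> unit_cube" and BQ: "B - Q \<in> sets borel" "B - Q \<subseteq> unit_cube"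
      using * by auto
    let ?E = "\<lambda>(a, S). {w \<in> space M. X a w \<in> Q \<and> (\<forall>i\<in>S. X i w \<in> B - Q) \<and> (\<forall>i\<in>{1..n} - {a} - S. X i w \<notin> B)}"
    let ?Z = "SIGMA a:{1..n}. {S. S \<subseteq> {1..n} - {a} \<and> card S \<le> k - 1}"
    have ev: "?E z \<in> events" if "z \<in> ?Z" for z
      using that Xev[OF _ *(1)] all_ev[OF _ BQ(1)] all_ev[of _ "- B"] *(2)
      by (auto intro!: sets.sets_Collect_conj)
    have b: "0 \<le> ?b - ?q" "?b \<le> 1" "?q \<le> 1" "?b - ?q \<le> ?c"
      using vol_mono_in_cube[OF *(3,1,2,4)] vol_le_1[OF *(2,4)] vol_le_1[OF *(1) Qc] vol_Diff_ge[OF *(2,4,1) Qc]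
      by auto
    have disj: "disjoint_family_on ?E ?Z"
      unfolding disjoint_family_on_def
    proof (intro ballI impI)
      fix z z' assume z: "z \<in> ?Z" "z' \<in> ?Z" "z \<noteq> z'"
      obtain a S a' S' where zz: "z = (a, S)" "z' = (a', S')"
        by (cases z, cases z') simp
      have aS: "a \<in> {1..n}" "S \<subseteq> {1..n} - {a}" "a' \<in> {1..n}" "S' \<subseteq> {1..n} - {a'}"
        using z(1,2) unfolding zz by simp_all
      have clash: False if w: "w \<in> ?E (a, S)" "w \<in> ?E (a', S')" for w
      proof -
        note eq = pattern_unique[OF *(3) aS(1,2), of "\<lambda>i. X i w"] pattern_unique[OF *(3) aS(3,4), of "\<lambda>i. X i w"]
        have "{i \<in> {1..n}. X i w \<in> Q} = {a}" "{i \<in> {1..n}. X i w \<in> B - Q} = S"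
          by (rule eq; use w(1) in simp)+
        moreover have "{i \<in> {1..n}. X i w \<in> Q} = {a'}" "{i \<in> {1..n}. X i w \<in> B - Q} = S'"
          by (rule eq; use w(2) in simp)+
        ultimately show False
          using z(3) unfolding zz by simp
      qed
      show "?E z \<inter> ?E z' = {}"
      proof (rule equals0I)
        fix w assume w: "w \<in> ?E z \<inter> ?E z'"
        show False
          by (rule clash[OF IntD1[OF w[unfolded zz]] IntD2[OF w[unfolded zz]]])
      qed
    qed
    have summand: "real ((n - 1) choose i) * (?b ^ i * (1 - ?b) ^ (n - 1 - i)) - real ((n - 1) choose i) * real i * ?q
        \<le> real ((n - 1) choose i) * (?c ^ i * (1 - ?b) ^ (n - 1 - i))" for i
    proof -
      have "?b ^ i - (?b - ?q) ^ i \<le> real i * ?q"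
      proof -
        have "?b - ?q \<le> 1"
          using b(2) measure_nonneg[of lborel Q] by linarith
        then show ?thesis
          using norm_power_diff[of ?b "?b - ?q" i] b by (simp add: abs_le_iff)
      qed
      moreover have "(?b - ?q) ^ i \<le> ?c ^ i"
        using b by (intro power_mono) auto
      ultimately have "?b ^ i - ?c ^ i \<le> real i * ?q"
        by linarith
      then have "(?b ^ i - ?c ^ i) * (1 - ?b) ^ (n - 1 - i) \<le> real i * ?q * (1 - ?b) ^ (n - 1 - i)"
        using b by (intro mult_right_mono) auto
      also have "\<dots> \<le> real i * ?q * 1"
        using b by (intro mult_left_mono power_le_one) auto
      finally have "real ((n - 1) choose i) * ((?b ^ i - ?c ^ i) * (1 - ?b) ^ (n - 1 - i)) \<le> real ((n - 1) choose i) * (real i * ?q)"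
        by (intro mult_left_mono) auto
      then show ?thesis
        by (simp add: algebra_simps)
    qed
    have "binomial_cdf (n - 1) (k - 1) ?b - ?K * ?q \<le> (\<Sum>i\<le>k - 1. real ((n - 1) choose i) * (?c ^ i * (1 - ?b) ^ (n - 1 - i)))"
      unfolding binomial_cdf_def sum_distrib_right sum_subtractf[symmetric] by (rule sum_mono) (rule summand)
    then have "real n * ?q * (binomial_cdf (n - 1) (k - 1) ?b - ?K * ?q)
        \<le> real n * ?q * (\<Sum>i\<le>k - 1. real ((n - 1) choose i) * (?c ^ i * (1 - ?b) ^ (n - 1 - i)))"
      by (intro mult_left_mono) auto
    also have "\<dots> = (\<Sum>a\<in>{1..n}. ?q * (\<Sum>i\<le>k - 1. real ((n - 1) choose i) * (?c ^ i * (1 - ?b) ^ (n - 1 - i))))"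
      by simp
    also have "\<dots> = (\<Sum>a\<in>{1..n}. \<Sum>S | S \<subseteq> {1..n} - {a} \<and> card S \<le> k - 1. ?q * (?c ^ card S * (1 - ?b) ^ (n - 1 - card S)))"
    proof (rule sum.cong[OF refl])
      fix a assume "a \<in> {1..n}"
      then show "?q * (\<Sum>i\<le>k - 1. real ((n - 1) choose i) * (?c ^ i * (1 - ?b) ^ (n - 1 - i)))
        = (\<Sum>S | S \<subseteq> {1..n} - {a} \<and> card S \<le> k - 1. ?q * (?c ^ card S * (1 - ?b) ^ (n - 1 - card S)))"
        unfolding sum_distrib_left[symmetric]
        by (subst sum_over_small_subsets) auto
    qed
    also have "\<dots> = (\<Sum>a\<in>{1..n}. \<Sum>S | S \<subseteq> {1..n} - {a} \<and> card S \<le> k - 1. prob (?E (a, S)))"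
    proof (intro sum.cong refl)
      fix a S assume "a \<in> {1..n}" "S \<in> {S. S \<subseteq> {1..n} - {a} \<and> card S \<le> k - 1}"
      then show "?q * (?c ^ card S * (1 - ?b) ^ (n - 1 - card S)) = prob (?E (a, S))"
        unfolding prod.case using *(1,2,4) Qc BQ by (intro iid_uniform_prob_pattern[OF X, symmetric]) auto
    qed
    also have "\<dots> = (\<Sum>z\<in>?Z. prob (?E z))"
      by (subst sum.Sigma) (auto intro!: sum.cong)
    also have "\<dots> = prob (\<Union>z\<in>?Z. ?E z)"
      using ev by (intro finite_measure_finite_Union[symmetric] disj) auto
    also have "\<dots> \<le> prob {w \<in> space M. 1 \<le> num_points (binomial_process X n w) Q \<and> num_points (binomial_process X n w) B \<le> k}"
    proof (rule finite_measure_mono)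
      show "(\<Union>z\<in>?Z. ?E z) \<subseteq> {w \<in> space M. 1 \<le> num_points (binomial_process X n w) Q \<and> num_points (binomial_process X n w) B \<le> k}"
      proof
        fix w assume "w \<in> (\<Union>z\<in>?Z. ?E z)"
        then obtain a S where aS: "a \<in> {1..n}" "S \<subseteq> {1..n} - {a}" "card S \<le> k - 1" and w: "w \<in> ?E (a, S)"
          by blast
        have "{i \<in> {1..n}. X i w \<in> B} \<subseteq> insert a S"
          using w by auto
        then have "num_points (binomial_process X n w) B \<le> card (insert a S)"
          unfolding num_points_binomial_process using finite_subset[OF aS(2)] by (intro card_mono) auto
        also have "\<dots> \<le> Suc (card S)"
          by (rule card_insert_le_m1[THEN order_trans, of "Suc (card S)"]) auto
        also have "\<dots> \<le> k"
          using aS(3) k by simp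
        finally show "w \<in> {w \<in> space M. 1 \<le> num_points (binomial_process X n w) Q \<and> num_points (binomial_process X n w) B \<le> k}"
          unfolding mem_Collect_eq pos using w aS(1) by blast
      qed
      show "{w \<in> space M. 1 \<le> num_points (binomial_process X n w) Q \<and> num_points (binomial_process X n w) B \<le> k} \<in> events"
        using * by (intro sets.sets_Collect_conj count_ev)
    qed
    finally show "real n * ?q * (binomial_cdf (n - 1) (k - 1) ?b - ?K * ?q)
        \<le> prob {w \<in> space M. 1 \<le> num_points (binomial_process X n w) Q \<and> num_points (binomial_process X n w) B \<le> k}" .
  next
    fix Q Q' B D :: "(real ^ 'd) set" and m m' :: nat
    assume *: "Q \<in> sets borel" "Q' \<in> sets borel" "B \<in> sets borel" "D \<in> sets borel"
      "Q \<subseteq> unit_cube" "Q' \<subseteq> unit_cube" "B \<subseteq> unit_cube" "D \<subseteq> unit_cube"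
      "Q \<inter> Q' = {}" "Q \<inter> B = {}" "Q \<inter> D = {}" "Q' \<inter> B = {}" "Q' \<inter> D = {}" "B \<inter> D = {}" "m \<le> k" "m' \<le> k"
    let ?S = "\<lambda>m. {S. S \<subseteq> {1..n} \<and> card S \<le> m}"
    let ?E = "\<lambda>(a, c, S, S'). {w \<in> space M. X a w \<in> Q \<and> X c w \<in> Q' \<and> (\<forall>i\<in>S. X i w \<in> B) \<and> (\<forall>i\<in>S'. X i w \<in> D)
            \<and> (\<forall>i\<in>{1..n} - ({a, c} \<union> S \<union> S'). X i w \<notin> B \<union> D)}"
    let ?Z = "{1..n} \<times> {1..n} \<times> ?S m \<times> ?S m'"
    let ?b = "measure lborel B" and ?d = "measure lborel D"
    let ?C = "measure lborel Q * measure lborel Q' * (exp (2 * real k + 2) * exp (- real n * (?b + ?d)))"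
    have ev: "?E z \<in> events" if "z \<in> ?Z" for z
      using that Xev[OF _ *(1)] Xev[OF _ *(2)] all_ev[OF _ *(3)] all_ev[OF _ *(4)] all_ev[of _ "- (B \<union> D)"] *(3,4)
      by (cases z) (auto intro!: sets.sets_Collect_conj)
    have Cnn: "0 \<le> ?C"
      by simp
    have "prob {w \<in> space M. 1 \<le> num_points (binomial_process X n w) Q \<and> 1 \<le> num_points (binomial_process X n w) Q'
               \<and> num_points (binomial_process X n w) B \<le> m \<and> num_points (binomial_process X n w) D \<le> m'}
        \<le> prob (\<Union>z\<in>?Z. ?E z)"
    proof (rule finite_measure_mono)
      show "{w \<in> space M. 1 \<le> num_points (binomial_process X n w) Q \<and> 1 \<le> num_points (binomial_process X n w) Q'
               \<and> num_points (binomial_process X n w) B \<le> m \<and> num_points (binomial_process X n w) D \<le> m'}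
          \<subseteq> (\<Union>z\<in>?Z. ?E z)"
      proof
        fix w assume "w \<in> {w \<in> space M. 1 \<le> num_points (binomial_process X n w) Q \<and> 1 \<le> num_points (binomial_process X n w) Q'
               \<and> num_points (binomial_process X n w) B \<le> m \<and> num_points (binomial_process X n w) D \<le> m'}"
        then obtain a c where w: "w \<in> space M" "num_points (binomial_process X n w) B \<le> m"
            "num_points (binomial_process X n w) D \<le> m'"
          and ac: "a \<in> {1..n}" "X a w \<in> Q" "c \<in> {1..n}" "X c w \<in> Q'"
          unfolding pos by blast
        have "(a, c, {i \<in> {1..n}. X i w \<in> B}, {i \<in> {1..n}. X i w \<in> D}) \<in> ?Z"
          using ac w unfolding num_points_binomial_process by auto
        moreover have "w \<in> ?E (a, c, {i \<in> {1..n}. X i w \<in> B}, {i \<in> {1..n}. X i w \<in> D})"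
          using w(1) ac by auto
        ultimately show "w \<in> (\<Union>z\<in>?Z. ?E z)"
          by (rule UN_I)
      qed
      show "(\<Union>z\<in>?Z. ?E z) \<in> events"
        using ev by (intro sets.finite_UN) auto
    qed
    also have "\<dots> \<le> (\<Sum>z\<in>?Z. prob (?E z))"
      using ev by (intro finite_measure_subadditive_finite) auto
    also have "\<dots> \<le> (\<Sum>(a, c, S, S')\<in>?Z. ?C * (?b ^ card S * ?d ^ card S'))"
    proof (rule sum_mono)
      fix z assume z: "z \<in> ?Z"
      obtain a c S S' where z_eq: "z = (a, c, S, S')"
        by (cases z)
      have "prob (?E z) \<le> measure lborel Q * measure lborel Q' * (?b ^ card S * ?d ^ card S')
          * (exp (2 * real k + 2) * exp (- real n * (?b + ?d)))"
        unfolding z_eq prod.case using z * by (intro iid_uniform_prob_two_points[OF X]) (auto simp: z_eq)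
      then show "prob (?E z) \<le> (case z of (a, c, S, S') \<Rightarrow> ?C * (?b ^ card S * ?d ^ card S'))"
        by (simp add: z_eq mult_ac)
    qed
    also have "\<dots> = (\<Sum>a\<in>{1..n}. \<Sum>c\<in>{1..n}. \<Sum>S\<in>?S m. \<Sum>S'\<in>?S m'. ?C * (?b ^ card S * ?d ^ card S'))"
      by (simp only: sum.cartesian_product)
    also have "\<dots> = real n * real n * ?C * ((\<Sum>S\<in>?S m. ?b ^ card S) * (\<Sum>S'\<in>?S m'. ?d ^ card S'))"
      by (simp add: sum_distrib_left[symmetric] sum_distrib_right[symmetric])
    also have "\<dots> \<le> real n * real n * ?C * ((\<Sum>i\<le>m. (real n * ?b) ^ i / fact i) * (\<Sum>i\<le>m'. (real n * ?d) ^ i / fact i))"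
      using Cnn by (intro mult_left_mono mult_mono sum_small_subsets_le sum_nonneg mult_nonneg_nonneg) auto
    also have "\<dots> = exp (2 * real k + 2) * (real n)\<^sup>2 * measure lborel Q * measure lborel Q'
          * poisson_cdf m (real n * ?b) * poisson_cdf m' (real n * ?d)"
      by (simp add: poisson_cdf_def power2_eq_square exp_add[symmetric] algebra_simps)
    finally show "prob {w \<in> space M. 1 \<le> num_points (binomial_process X n w) Q \<and> 1 \<le> num_points (binomial_process X n w) Q'
               \<and> num_points (binomial_process X n w) B \<le> m \<and> num_points (binomial_process X n w) D \<le> m'}
        \<le> exp (2 * real k + 2) * (real n)\<^sup>2 * measure lborel Q * measure lborel Q'
          * poisson_cdf m (real n * ?b) * poisson_cdf m' (real n * ?d)" .
  qed
qed

section \<open>Asymptotics\<close>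

text \<open>After division by \<open>a\<^sup>m\<close> the \<open>i\<close>-th summand is of order \<open>a\<^bsup>i-m\<^esup>\<close>, so only the last one survives.
  The coefficients \<open>c\<close> and the exponential factors \<open>e\<close> are left general to cover the binomial law too.\<close>

lemma poisson_scaling_limit:
  fixes a x :: "nat \<Rightarrow> real" and c :: "nat \<Rightarrow> nat \<Rightarrow> real" and e :: "nat \<Rightarrow> nat \<Rightarrow> real"
  assumes a: "filterlim a at_top sequentially" and x: "\<And>n. x n = a n + s0"
    and c: "\<And>i. i \<le> m \<Longrightarrow> (c i) \<longlonglongrightarrow> 1 / fact i"
    and e: "\<And>i. i \<le> m \<Longrightarrow> (\<lambda>n. e i n * exp (a n)) \<longlonglongrightarrow> exp (- s0)"
  shows "(\<lambda>n. (\<Sum>i\<le>m. c i n * x n ^ i * e i n) / (a n ^ m * exp (- a n))) \<longlonglongrightarrow> exp (- s0) / fact m"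
proof -
  have inv: "(\<lambda>n. inverse (a n)) \<longlonglongrightarrow> 0"
    by (rule tendsto_inverse_0_at_top[OF a])
  have "(\<lambda>n. 1 + s0 * inverse (a n)) \<longlonglongrightarrow> 1 + s0 * 0"
    by (intro tendsto_intros inv)
  then have xa: "(\<lambda>n. 1 + s0 * inverse (a n)) \<longlonglongrightarrow> 1"
    by simp
  have "(\<lambda>n. \<Sum>i\<le>m. c i n * (1 + s0 * inverse (a n)) ^ i * inverse (a n) ^ (m - i) * (e i n * exp (a n)))
      \<longlonglongrightarrow> (\<Sum>i\<le>m. 1 / fact i * 1 ^ i * 0 ^ (m - i) * exp (- s0))"
    by (intro tendsto_sum tendsto_mult tendsto_power xa inv c e) auto
  also have "(\<Sum>i\<le>m. 1 / fact i * 1 ^ i * 0 ^ (m - i) * exp (- s0)) = (\<Sum>i\<in>{m}. 1 / fact i * 1 ^ i * 0 ^ (m - i) * exp (- s0))"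
    by (rule sum.mono_neutral_right) auto
  also have "\<dots> = exp (- s0) / fact m"
    by simp
  finally have "(\<lambda>n. \<Sum>i\<le>m. c i n * (1 + s0 * inverse (a n)) ^ i * inverse (a n) ^ (m - i) * (e i n * exp (a n)))
      \<longlonglongrightarrow> exp (- s0) / fact m" .
  moreover have "eventually (\<lambda>n. (\<Sum>i\<le>m. c i n * (1 + s0 * inverse (a n)) ^ i * inverse (a n) ^ (m - i) * (e i n * exp (a n)))
      = (\<Sum>i\<le>m. c i n * x n ^ i * e i n) / (a n ^ m * exp (- a n))) sequentially"
    using filterlim_at_top_dense[THEN iffD1, OF a, rule_format, of 0]
  proof eventually_elim
    case (elim n)
    have "c i n * (1 + s0 * inverse (a n)) ^ i * inverse (a n) ^ (m - i) * (e i n * exp (a n))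
        = c i n * x n ^ i * e i n / (a n ^ m * exp (- a n))" if i: "i \<le> m" for i
    proof -
      have "1 + s0 * inverse (a n) = x n / a n"
        using elim by (simp add: x field_simps)
      moreover have "a n ^ m = a n ^ i * a n ^ (m - i)"
        using i by (simp add: power_add[symmetric])
      ultimately show ?thesis
        using elim by (simp add: power_divide exp_minus field_simps)
    qed
    then show ?case
      by (simp add: sum_divide_distrib)
  qed
  ultimately show ?thesis
    by (rule Lim_transform_eventually)
qed

lemma poisson_cdf_scaling_limit:
  fixes a x :: "nat \<Rightarrow> real"
  assumes a: "filterlim a at_top sequentially" and x: "\<And>n. x n = a n + s0"
  shows "(\<lambda>n. poisson_cdf m (x n) / (a n ^ m * exp (- a n))) \<longlonglongrightarrow> exp (- s0) / fact m"
proof -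
  have "(\<lambda>n. (\<Sum>i\<le>m. 1 / fact i * x n ^ i * exp (- x n)) / (a n ^ m * exp (- a n))) \<longlonglongrightarrow> exp (- s0) / fact m"
    by (rule poisson_scaling_limit[OF a x]) (simp_all add: x exp_add[symmetric])
  then show ?thesis
    by (simp add: poisson_cdf_def sum_distrib_right)
qed

text \<open>With \<open>v = x / n\<close>, the power \<open>(1 - v)\<^sup>n\<close> lies between \<open>exp (- n v - 2 n v\<^sup>2)\<close> and \<open>exp (- n v)\<close>; the two agree in
  the limit because \<open>n v\<^sup>2 = x\<^sup>2 / n\<close> tends to \<open>0\<close>.\<close>

lemma binomial_cdf_scaling_limit:
  fixes a x :: "nat \<Rightarrow> real"
  assumes a: "filterlim a at_top sequentially" and x: "\<And>n. x n = a n + s0"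
    and sq: "(\<lambda>n. x n ^ 2 / real n) \<longlonglongrightarrow> 0" and lin: "(\<lambda>n. x n / real n) \<longlonglongrightarrow> 0"
  shows "(\<lambda>n. binomial_cdf (n - 1) m (x n / real n) / (a n ^ m * exp (- a n))) \<longlonglongrightarrow> exp (- s0) / fact m"
proof -
  let ?c = "\<lambda>i n. real ((n - 1) choose i) / real n ^ i"
  let ?e = "\<lambda>i n. (1 - x n / real n) ^ (n - 1 - i)"
  have c: "?c i \<longlonglongrightarrow> 1 / fact i" for i
  proof -
    have eq: "?c i n = (\<Prod>j = 0..<i. (real (n - 1) - real j) / real n) / fact i" for n
      by (simp add: binomial_gbinomial gbinomial_prod_rev prod_dividef)
    have "(\<lambda>n. (real (n - 1) - real j) / real n) \<longlonglongrightarrow> 1" for j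
    proof -
      have "(\<lambda>n. (real n - 1 - real j) / real n) \<longlonglongrightarrow> 1"
        by real_asymp
      moreover have "eventually (\<lambda>n. (real n - 1 - real j) / real n = (real (n - 1) - real j) / real n) sequentially"
        using eventually_ge_at_top[of 1] by eventually_elim (simp add: of_nat_diff)
      ultimately show ?thesis
        by (rule Lim_transform_eventually)
    qed
    then have "(\<lambda>n. (\<Prod>j = 0..<i. (real (n - 1) - real j) / real n) / fact i) \<longlonglongrightarrow> (\<Prod>j = 0..<i. 1) / fact i"
      by (intro tendsto_divide tendsto_prod tendsto_const) auto
    then show ?thesis
      unfolding eq by simp
  qed
  have e: "(\<lambda>n. ?e i n * exp (a n)) \<longlonglongrightarrow> exp (- s0)" for i
  proof (rule tendsto_sandwich)
    have "(\<lambda>n. exp (- s0 - 2 * (x n ^ 2 / real n))) \<longlonglongrightarrow> exp (- s0 - 2 * 0)"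
      by (intro tendsto_intros sq)
    then show "(\<lambda>n. exp (- s0 - 2 * (x n ^ 2 / real n))) \<longlonglongrightarrow> exp (- s0)"
      by simp
    have "(\<lambda>n. exp (- s0 + (1 + real i) * (x n / real n))) \<longlonglongrightarrow> exp (- s0 + (1 + real i) * 0)"
      by (intro tendsto_intros lin)
    then show "(\<lambda>n. exp (- s0 + (1 + real i) * (x n / real n))) \<longlonglongrightarrow> exp (- s0)"
      by simp
    have v: "eventually (\<lambda>n. x n / real n < 1/2) sequentially"
      using lin by (rule order_tendstoD) simp
    have pos: "eventually (\<lambda>n. - s0 < a n) sequentially"
      using filterlim_at_top_dense[THEN iffD1, OF a, rule_format] .
    show "eventually (\<lambda>n. exp (- s0 - 2 * (x n ^ 2 / real n)) \<le> ?e i n * exp (a n)) sequentially"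
      using v pos eventually_gt_at_top[of 0]
    proof eventually_elim
      case (elim n)
      let ?v = "x n / real n"
      have v: "0 \<le> ?v" "?v \<le> 1/2"
        using elim by (auto simp: x)
      have "exp (- x n - 2 * (x n ^ 2 / real n)) = exp (real n * (- ?v - 2 * ?v\<^sup>2))"
        using elim by (simp add: field_simps power2_eq_square)
      also have "\<dots> \<le> exp (real n * ln (1 - ?v))"
        using ln_one_minus_pos_lower_bound[OF v] by (simp add: mult_left_mono)
      also have "\<dots> = (1 - ?v) ^ n"
      proof -
        have "0 < 1 - ?v"
          using v by linarith
        then show ?thesis
          unfolding exp_of_nat_mult by simp
      qed
      also have "\<dots> \<le> ?e i n"
      proof (rule power_decreasing)
        show "0 \<le> 1 - ?v" "1 - ?v \<le> 1"
          using v by linarith+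
      qed simp
      finally have "exp (- x n - 2 * (x n ^ 2 / real n)) * exp (a n) \<le> ?e i n * exp (a n)"
        by (rule mult_right_mono) simp
      then show ?case
        by (simp add: exp_add[symmetric] x algebra_simps)
    qed
    show "eventually (\<lambda>n. ?e i n * exp (a n) \<le> exp (- s0 + (1 + real i) * (x n / real n))) sequentially"
      using v pos eventually_gt_at_top[of "i + 1"]
    proof eventually_elim
      case (elim n)
      let ?v = "x n / real n"
      have v: "0 \<le> ?v" "?v \<le> 1/2"
        using elim by (auto simp: x)
      have "?e i n \<le> exp (- ?v) ^ (n - 1 - i)"
      proof (rule power_mono)
        show "1 - ?v \<le> exp (- ?v)"
          using exp_ge_add_one_self[of "- ?v"] by linarith
        show "0 \<le> 1 - ?v"
          using v by linarith
      qed
      also have "\<dots> = exp (real (n - 1 - i) * - ?v)"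
        by (rule exp_of_nat_mult[symmetric])
      also have "real (n - 1 - i) * - ?v = - x n + (1 + real i) * ?v"
        using elim by (simp add: of_nat_diff field_simps)
      finally have "?e i n * exp (a n) \<le> exp (- x n + (1 + real i) * ?v) * exp (a n)"
        by (rule mult_right_mono) simp
      then show ?case
        by (simp add: exp_add[symmetric] x algebra_simps)
    qed
  qed
  have "(\<lambda>n. (\<Sum>i\<le>m. ?c i n * x n ^ i * ?e i n) / (a n ^ m * exp (- a n))) \<longlonglongrightarrow> exp (- s0) / fact m"
    by (rule poisson_scaling_limit[OF a x c e])
  then show ?thesis
    by (simp add: binomial_cdf_def power_divide mult.assoc)
qed

text \<open>For the decay of \<open>b\<close>, distinguish whether \<open>a \<le> 2 ln n\<close>.  If so, \<open>a\<^sup>m\<close> is at most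
  \<open>2\<^sup>m (ln n)\<^sup>m\<close> and the hypothesis on \<open>a\<close> absorbs both \<open>n\<close> and \<open>(ln n)\<^sup>m\<close>; otherwise
  \<open>n \<le> exp (a / 2)\<close>.\<close>

lemma threshold_limits:
  fixes a b :: "nat \<Rightarrow> real"
  assumes thr: "filterlim (\<lambda>n. a n - ln (real n) - real m * ln (ln (real n))) at_top sequentially"
    and b: "\<And>n. b n = real n * a n ^ m * exp (- a n)"
  shows "filterlim a at_top sequentially" and "b \<longlonglongrightarrow> 0"
proof -
  define c where "c n = a n - ln (real n) - real m * ln (ln (real n))" for n
  have c: "filterlim c at_top sequentially"
    using thr by (simp add: c_def[abs_def])
  have "filterlim (\<lambda>n::nat. ln (ln (real n))) at_top sequentially"
    by real_asymp
  then have loglog: "eventually (\<lambda>n. 0 < ln (ln (real n))) sequentially"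
    by (rule filterlim_at_top_dense[THEN iffD1, rule_format])
  have "filterlim (\<lambda>n::nat. ln (real n)) at_top sequentially"
    by real_asymp
  then have log: "eventually (\<lambda>n. 0 < ln (real n)) sequentially"
    by (rule filterlim_at_top_dense[THEN iffD1, rule_format])
  show a: "filterlim a at_top sequentially"
  proof (rule filterlim_at_top_mono[OF c])
    show "eventually (\<lambda>n. c n \<le> a n) sequentially"
      using loglog log
    proof eventually_elim
      case (elim n)
      have "0 \<le> real m * ln (ln (real n))"
        using elim by (intro mult_nonneg_nonneg) auto
      then show ?case
        unfolding c_def using elim by linarith
    qed
  qed
  have apos: "eventually (\<lambda>n. 0 < a n) sequentially"
    using a by (rule filterlim_at_top_dense[THEN iffD1, rule_format])
  have "((\<lambda>y::real. y ^ m * exp (- y / 2)) \<longlongrightarrow> 0) at_top"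
    by real_asymp
  then have 1: "(\<lambda>n. a n ^ m * exp (- a n / 2)) \<longlonglongrightarrow> 0"
    using a by (rule filterlim_compose)
  have "((\<lambda>y::real. 2 ^ m * exp (- y)) \<longlongrightarrow> 0) at_top"
    by real_asymp
  then have 2: "(\<lambda>n. 2 ^ m * exp (- c n)) \<longlonglongrightarrow> 0"
    using c by (rule filterlim_compose)
  have upper: "eventually (\<lambda>n. b n \<le> a n ^ m * exp (- a n / 2) + 2 ^ m * exp (- c n)) sequentially"
    using loglog log apos eventually_gt_at_top[of 0]
  proof eventually_elim
    case (elim n)
    show ?case
    proof (cases "a n \<le> 2 * ln (real n)")
      case True
      have "exp (- a n) = exp (- c n) * (exp (- ln (real n)) * exp (- (real m * ln (ln (real n)))))"
        by (simp add: c_def exp_add[symmetric])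
      also have "exp (- ln (real n)) = 1 / real n"
        using elim by (simp add: exp_minus field_simps)
      also have "exp (- (real m * ln (ln (real n)))) = 1 / ln (real n) ^ m"
        using elim by (simp add: exp_minus exp_of_nat_mult field_simps)
      finally have "b n = (a n / ln (real n)) ^ m * exp (- c n)"
        using elim by (simp add: b power_divide)
      also have "\<dots> \<le> 2 ^ m * exp (- c n)"
        using elim True by (intro mult_right_mono power_mono) (auto simp: field_simps)
      finally show ?thesis
        using elim by (simp add: add_increasing)
    next
      case False
      have "real n = exp (ln (real n))"
        using elim by simp
      also have "\<dots> \<le> exp (a n / 2)"
        using False by simp
      finally have "b n \<le> exp (a n / 2) * a n ^ m * exp (- a n)"
        unfolding b using elim by (intro mult_right_mono) auto
      also have "\<dots> = a n ^ m * (exp (a n / 2) * exp (- a n))"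
        by simp
      also have "exp (a n / 2) * exp (- a n) = exp (- a n / 2)"
        by (simp add: exp_add[symmetric])
      finally show ?thesis
        by (simp add: add_increasing2)
    qed
  qed
  have lower: "eventually (\<lambda>n. 0 \<le> b n) sequentially"
    using apos by eventually_elim (simp add: b)
  have "(\<lambda>n. a n ^ m * exp (- a n / 2) + 2 ^ m * exp (- c n)) \<longlonglongrightarrow> 0 + 0"
    by (intro tendsto_add 1 2)
  then show "b \<longlonglongrightarrow> 0"
    using tendsto_sandwich[OF lower upper tendsto_const] by simp
qed

text \<open>In \<open>n\<^sup>2 err / b\<close> the close pairs give \<open>\<epsilon>\<^sup>d L\<close> with \<open>L\<close> independent of \<open>\<epsilon>\<close>, the pairs at
  intermediate distance give \<open>x \<pi>(c x)\<close> with \<open>c > 0\<close>, which tends to \<open>0\<close>, and the distant pairs give a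
  multiple of \<open>b\<close>.\<close>

lemma palm_estimates_limit:
  fixes M :: "nat \<Rightarrow> 'a measure" and N :: "nat \<Rightarrow> 'a \<Rightarrow> (real ^ 'd) multiset"
    and a b r K :: "nat \<Rightarrow> real" and F :: "nat \<Rightarrow> real \<Rightarrow> real"
  assumes est: "eventually (\<lambda>n. palm_estimates (M n) (N n) (real n) C (K n) k (F n)) sequentially"
    and k: "1 \<le> k" and cont: "\<And>n v. isCont (F n) v"
    and r: "\<And>n. r n = ((a n + s0) / (real n * unit_ball_vol (real CARD('d)))) powr (1 / real CARD('d))"
    and b: "\<And>n. b n = real n * a n ^ (k - 1) * exp (- a n)"
    and a: "filterlim a at_top sequentially" and b0: "b \<longlonglongrightarrow> 0"
    and small: "(\<lambda>n. (a n + s0) / real n) \<longlonglongrightarrow> 0"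
    and F: "(\<lambda>n. real n * F n ((a n + s0) / real n) / b n) \<longlonglongrightarrow> exp (- s0) / fact (k - 1)"
  shows "(\<lambda>n. measure (M n) {w \<in> space (M n). low_degree_count k (r n) (N n w) \<ge> 1} / b n)
           \<longlonglongrightarrow> exp (- s0) / fact (k - 1)"
proof -
  define d where "d = CARD('d)"
  define \<theta> where "\<theta> = unit_ball_vol (real d)"
  define x where "x n = a n + s0" for n
  define \<alpha> where "\<alpha> = exp (- s0) / fact (k - 1)"
  define P where "P n = measure (M n) {w \<in> space (M n). low_degree_count k (r n) (N n w) \<ge> 1}" for n
  define p1 where "p1 n = of_bool (2 \<le> k) * poisson_cdf (k - 2) (x n)" for n
  define p2 where "p2 n = poisson_cdf (k - 1) (x n)" for n
  define err where "err \<epsilon> n = \<epsilon> ^ d * x n / real n * p1 n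
      + 2 ^ d * x n / real n * (p2 n * poisson_cdf (k - 1) ((\<epsilon> / 3) ^ d * x n)) + (p2 n)\<^sup>2" for \<epsilon> n
  have d: "0 < d"
    by (simp add: d_def)
  have \<theta>: "0 < \<theta>"
    by (simp add: \<theta>_def)
  then have \<theta>0: "unit_ball_vol (real CARD('d)) \<noteq> 0"
    unfolding \<theta>_def d_def by (metis less_irrefl)
  have pos: "eventually (\<lambda>n. 0 < a n \<and> 0 < x n \<and> 0 < b n \<and> 0 < real n) sequentially"
    using filterlim_at_top_dense[THEN iffD1, OF a, rule_format, of 0]
      filterlim_at_top_dense[THEN iffD1, OF a, rule_format, of "- s0"] eventually_gt_at_top[of 0]
    by eventually_elim (auto simp: x_def b)
  have vol: "ball_vol d (c * r n) = c ^ d * (x n / real n)" if "0 < x n" "0 < real n" for n c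
  proof -
    have "r n ^ d = r n powr real d"
      using that \<theta>0 by (subst powr_realpow) (auto simp: r x_def)
    also have "\<dots> = x n / (real n * \<theta>)"
      using that \<theta> d by (simp add: r powr_powr x_def \<theta>_def d_def)
    finally show ?thesis
      using \<theta> by (simp add: ball_vol_def power_mult_distrib \<theta>_def[symmetric])
  qed
  have rpos: "eventually (\<lambda>n. 0 < r n) sequentially"
    using pos by eventually_elim (use \<theta>0 in \<open>auto simp: r x_def\<close>)
  have rsmall: "eventually (\<lambda>n. r n < 3/14) sequentially"
  proof -
    have "(\<lambda>n. x n / real n / \<theta>) \<longlonglongrightarrow> 0 / \<theta>"
      using small by (intro tendsto_divide tendsto_const) (use \<theta> in \<open>auto simp: x_def\<close>)
    then have "eventually (\<lambda>n. x n / real n / \<theta> < (3/14) ^ d) sequentially"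
      by (rule order_tendstoD) (simp add: \<theta>)
    with pos rpos show ?thesis
    proof eventually_elim
      case (elim n)
      have "r n ^ d = x n / real n / \<theta>"
        using vol[of n 1] elim \<theta> by (simp add: ball_vol_def \<theta>_def[symmetric] field_simps)
      then have "r n ^ d < (3/14) ^ d"
        using elim by simp
      then show ?case
        by (rule power_less_imp_less_base) simp
    qed
  qed
  have bounds: "eventually (\<lambda>n. P n / b n \<le> real n * F n (x n / real n) / b n \<and>
      real n * F n (x n / real n) / b n - C * (real n)\<^sup>2 * err \<epsilon> n / b n \<le> P n / b n) sequentially"
    if \<epsilon>: "0 < \<epsilon>" "\<epsilon> \<le> 1" for \<epsilon>
    using est pos rpos rsmall
  proof eventually_elim
    case (elim n)
    interpret palm_estimates "M n" "N n" "real n" C "K n" k "F n"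
      by (rule elim(1))
    have P: "P n = prob (low_degree_event (r n))"
      unfolding P_def low_degree_event_def low_degree_count_ge_1_iff ..
    have V: "ball_vol CARD('d) (r n) = x n / real n" "ball_vol CARD('d) (\<epsilon> * r n) = \<epsilon> ^ d * (x n / real n)"
      "ball_vol CARD('d) (2 * r n) = 2 ^ d * (x n / real n)"
      "ball_vol CARD('d) (\<epsilon> * r n / 3) = (\<epsilon> / 3) ^ d * (x n / real n)"
      using vol[of n 1] vol[of n \<epsilon>] vol[of n 2] vol[of n "\<epsilon> / 3"] elim by (auto simp: d_def)
    have "P n \<le> real n * F n (x n / real n)"
      using low_degree_prob_upper[OF _ _ cont, of "r n"] elim by (simp add: P V)
    moreover have "real n * F n (x n / real n) - C * (real n)\<^sup>2 * err \<epsilon> n \<le> P n"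
      using low_degree_prob_lower[OF _ _ \<epsilon> cont, of "r n"] elim
      by (simp add: P V err_def p1_def p2_def)
    ultimately show ?case
      using elim by (simp add: divide_right_mono diff_divide_distrib[symmetric])
  qed
  have p2: "(\<lambda>n. real n * p2 n / b n) \<longlonglongrightarrow> \<alpha>"
  proof -
    have "(\<lambda>n. poisson_cdf (k - 1) (x n) / (a n ^ (k - 1) * exp (- a n))) \<longlonglongrightarrow> \<alpha>"
      unfolding \<alpha>_def by (rule poisson_cdf_scaling_limit[OF a]) (simp add: x_def)
    moreover have "eventually (\<lambda>n. poisson_cdf (k - 1) (x n) / (a n ^ (k - 1) * exp (- a n)) = real n * p2 n / b n) sequentially"
      using pos by eventually_elim (simp add: p2_def b)
    ultimately show ?thesis
      by (rule Lim_transform_eventually)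
  qed
  obtain L where L: "(\<lambda>n. real n * (x n * p1 n) / b n) \<longlonglongrightarrow> L"
  proof (cases "2 \<le> k")
    case True
    have ratio: "(\<lambda>n. x n * inverse (a n)) \<longlonglongrightarrow> 1"
    proof -
      have "(\<lambda>n. 1 + s0 * inverse (a n)) \<longlonglongrightarrow> 1 + s0 * 0"
        by (intro tendsto_intros tendsto_inverse_0_at_top a)
      moreover have "eventually (\<lambda>n. 1 + s0 * inverse (a n) = x n * inverse (a n)) sequentially"
        using pos by eventually_elim (simp add: x_def field_simps)
      ultimately show ?thesis
        using Lim_transform_eventually by fastforce
    qed
    have "(\<lambda>n. poisson_cdf (k - 2) (x n) / (a n ^ (k - 2) * exp (- a n))) \<longlonglongrightarrow> exp (- s0) / fact (k - 2)"
      by (rule poisson_cdf_scaling_limit[OF a]) (simp add: x_def)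
    then have "(\<lambda>n. (x n * inverse (a n)) * (poisson_cdf (k - 2) (x n) / (a n ^ (k - 2) * exp (- a n)))) \<longlonglongrightarrow> 1 * (exp (- s0) / fact (k - 2))"
      by (intro tendsto_mult ratio)
    moreover have "eventually (\<lambda>n. (x n * inverse (a n)) * (poisson_cdf (k - 2) (x n) / (a n ^ (k - 2) * exp (- a n)))
        = real n * (x n * p1 n) / b n) sequentially"
      using pos
    proof eventually_elim
      case (elim n)
      have "k - 1 = Suc (k - 2)"
        using True by simp
      then have "b n = real n * (a n * a n ^ (k - 2)) * exp (- a n)"
        by (simp add: b)
      then show ?case
        using elim True by (simp add: p1_def field_simps)
    qed
    ultimately have "(\<lambda>n. real n * (x n * p1 n) / b n) \<longlonglongrightarrow> 1 * (exp (- s0) / fact (k - 2))"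
      by (rule Lim_transform_eventually)
    then show ?thesis
      by (rule that)
  next
    case False
    then have "(\<lambda>n. real n * (x n * p1 n) / b n) \<longlonglongrightarrow> 0"
      by (simp add: p1_def)
    then show ?thesis
      by (rule that)
  qed
  have xtop: "filterlim x at_top sequentially"
    unfolding x_def using filterlim_tendsto_add_at_top[OF tendsto_const a, of s0] by (simp add: add.commute)
  have err: "(\<lambda>n. (real n)\<^sup>2 * err \<epsilon> n / b n) \<longlonglongrightarrow> \<epsilon> ^ d * L" if \<epsilon>: "0 < \<epsilon>" for \<epsilon>
  proof -
    define c where "c = (\<epsilon> / 3) ^ d"
    have c: "0 < c"
      using \<epsilon> by (simp add: c_def)
    have "((\<lambda>y::real. \<Sum>i\<le>k - 1. y * (c * y) ^ i / fact i * exp (- (c * y))) \<longlongrightarrow> (\<Sum>i\<le>k - 1. 0)) at_top"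
    proof (rule tendsto_sum)
      fix i
      show "((\<lambda>y::real. y * (c * y) ^ i / fact i * exp (- (c * y))) \<longlongrightarrow> 0) at_top"
        using c by real_asymp
    qed
    then have "((\<lambda>y. y * poisson_cdf (k - 1) (c * y)) \<longlongrightarrow> 0) at_top"
      by (simp add: poisson_cdf_def sum_distrib_left sum_distrib_right mult_ac)
    then have decay: "(\<lambda>n. x n * poisson_cdf (k - 1) (c * x n)) \<longlonglongrightarrow> 0"
      using xtop by (rule filterlim_compose)
    have "(\<lambda>n. \<epsilon> ^ d * (real n * (x n * p1 n) / b n)
        + 2 ^ d * (x n * poisson_cdf (k - 1) (c * x n)) * (real n * p2 n / b n)
        + b n * (real n * p2 n / b n)\<^sup>2) \<longlonglongrightarrow> \<epsilon> ^ d * L + 2 ^ d * 0 * \<alpha> + 0 * \<alpha>\<^sup>2"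
      by (intro tendsto_intros L decay p2 b0)
    moreover have "eventually (\<lambda>n. \<epsilon> ^ d * (real n * (x n * p1 n) / b n)
        + 2 ^ d * (x n * poisson_cdf (k - 1) (c * x n)) * (real n * p2 n / b n)
        + b n * (real n * p2 n / b n)\<^sup>2 = (real n)\<^sup>2 * err \<epsilon> n / b n) sequentially"
      using pos by eventually_elim (simp add: err_def c_def power2_eq_square field_simps)
    ultimately have "(\<lambda>n. (real n)\<^sup>2 * err \<epsilon> n / b n) \<longlonglongrightarrow> \<epsilon> ^ d * L + 2 ^ d * 0 * \<alpha> + 0 * \<alpha>\<^sup>2"
      by (rule Lim_transform_eventually)
    then show ?thesis
      by simp
  qed
  have "(\<lambda>n. P n / b n) \<longlonglongrightarrow> \<alpha>"
  proof (rule order_tendstoI)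
    fix y assume "\<alpha> < y"
    then have "eventually (\<lambda>n. real n * F n (x n / real n) / b n < y) sequentially"
      using F by (intro order_tendstoD) (auto simp: \<alpha>_def x_def)
    with bounds[of 1] show "eventually (\<lambda>n. P n / b n < y) sequentially"
      by (auto elim: eventually_elim2)
  next
    fix y assume y: "y < \<alpha>"
    have "((\<lambda>\<epsilon>. \<alpha> - C * (\<epsilon> ^ d * L)) \<longlongrightarrow> \<alpha> - C * (0 ^ d * L)) (at_right 0)"
      by (intro tendsto_intros)
    then have "eventually (\<lambda>\<epsilon>. y < \<alpha> - C * (\<epsilon> ^ d * L)) (at_right 0)"
      by (rule order_tendstoD) (use y d in \<open>simp add: zero_power\<close>)
    moreover have "eventually (\<lambda>\<epsilon>::real. \<epsilon> \<in> {0<..<1}) (at_right 0)"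
      by (rule eventually_at_right_real) simp
    ultimately have "eventually (\<lambda>\<epsilon>. y < \<alpha> - C * (\<epsilon> ^ d * L) \<and> \<epsilon> \<in> {0<..<1}) (at_right 0)"
      by (rule eventually_conj)
    then obtain \<epsilon> where \<epsilon>: "y < \<alpha> - C * (\<epsilon> ^ d * L)" "0 < \<epsilon>" "\<epsilon> < 1"
      using eventually_happens'[OF trivial_limit_at_right_real] by force
    have "(\<lambda>n. real n * F n (x n / real n) / b n - C * ((real n)\<^sup>2 * err \<epsilon> n / b n)) \<longlonglongrightarrow> \<alpha> - C * (\<epsilon> ^ d * L)"
      using F \<epsilon> by (intro tendsto_intros err) (auto simp: \<alpha>_def x_def)
    then have "eventually (\<lambda>n. y < real n * F n (x n / real n) / b n - C * ((real n)\<^sup>2 * err \<epsilon> n / b n)) sequentially"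
      using \<epsilon>(1) by (rule order_tendstoD)
    with bounds[of \<epsilon>] show "eventually (\<lambda>n. y < P n / b n) sequentially"
      using \<epsilon> by (auto elim: eventually_elim2)
  qed
  then show ?thesis
    by (simp add: P_def \<alpha>_def)
qed

theorem corollary3p3:
  fixes k :: nat and s0 \<theta> \<alpha> :: real
    and a b r :: "nat \<Rightarrow> real"
    and M :: "nat \<Rightarrow> 'p measure" and N :: "nat \<Rightarrow> 'p \<Rightarrow> (real ^ 'd) multiset"
    and M' :: "'q measure" and X :: "nat \<Rightarrow> 'q \<Rightarrow> real ^ 'd"
  assumes "k \<ge> 1"
    and "\<theta> = measure lborel (cball (0 :: real ^ 'd) 1)"
    and "\<And>n. r n = ((a n + s0) / (real n * \<theta>)) powr (1 / real CARD('d))"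
    and "\<And>n. b n = real n * a n ^ (k - 1) * exp (- a n)"
    and "\<alpha> = exp (- s0) / fact (k - 1)"
    and "filterlim (\<lambda>n. a n - ln (real n) - (real k - 1) * ln (ln (real n))) at_top sequentially"
  shows "(a \<in> o(\<lambda>n. real n) \<and> (\<forall>n\<ge>1. poisson_process (M n) (N n) (real n)) \<longrightarrow>
           (\<lambda>n. measure (M n) {w \<in> space (M n). low_degree_count k (r n) (N n w) \<ge> 1} / b n)
             \<longlonglongrightarrow> \<alpha>)
       \<and> (a \<in> o(\<lambda>n. real n powr (1 / 3)) \<and> iid_uniform M' X \<longrightarrow>
           (\<lambda>n. measure M' {w \<in> space M'. low_degree_count k (r n) (binomial_process X n w) \<ge> 1} / b n)
             \<longlonglongrightarrow> \<alpha>)"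
proof (intro conjI impI; elim conjE)
  have k: "1 \<le> k"
    using assms(1) .
  have r: "r n = ((a n + s0) / (real n * unit_ball_vol (real CARD('d)))) powr (1 / real CARD('d))" for n
    using content_cball[of 1 "0 :: real ^ 'd"] by (simp add: assms(2,3))
  have thr: "filterlim (\<lambda>n. a n - ln (real n) - real (k - 1) * ln (ln (real n))) at_top sequentially"
    using assms(6) k by (simp add: of_nat_diff)
  note lim = threshold_limits[OF thr assms(4)]
  {
    assume small: "a \<in> o(\<lambda>n. real n)" and pp: "\<forall>n\<ge>1. poisson_process (M n) (N n) (real n)"
    have "(\<lambda>n. a n / real n + s0 / real n) \<longlonglongrightarrow> 0 + 0"
      by (intro tendsto_add smalloD_tendsto[OF small] lim_const_over_n)
    then have small': "(\<lambda>n. (a n + s0) / real n) \<longlonglongrightarrow> 0"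
      by (simp add: add_divide_distrib)
    have "(\<lambda>n. poisson_cdf (k - 1) (a n + s0) / (a n ^ (k - 1) * exp (- a n))) \<longlonglongrightarrow> exp (- s0) / fact (k - 1)"
      by (rule poisson_cdf_scaling_limit[OF lim(1)]) simp
    moreover have "eventually (\<lambda>n. poisson_cdf (k - 1) (a n + s0) / (a n ^ (k - 1) * exp (- a n))
        = real n * poisson_cdf (k - 1) (real n * ((a n + s0) / real n)) / b n) sequentially"
      using eventually_gt_at_top[of 0] by eventually_elim (simp add: assms(4))
    ultimately have F: "(\<lambda>n. real n * poisson_cdf (k - 1) (real n * ((a n + s0) / real n)) / b n)
        \<longlonglongrightarrow> exp (- s0) / fact (k - 1)"
      by (rule Lim_transform_eventually)
    have est: "eventually (\<lambda>n. palm_estimates (M n) (N n) (real n) 1 (real n) k (\<lambda>v. poisson_cdf (k - 1) (real n * v)))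
        sequentially"
      using eventually_ge_at_top[of 1]
    proof eventually_elim
      case (elim n)
      show ?case
        by (rule poisson_process_estimates) (use elim pp k in simp_all)
    qed
    have cont: "isCont (\<lambda>v. poisson_cdf (k - 1) (real n * v)) v" for n v
      by (intro isCont_o2[OF _ isCont_poisson_cdf] continuous_intros)
    show "(\<lambda>n. measure (M n) {w \<in> space (M n). low_degree_count k (r n) (N n w) \<ge> 1} / b n) \<longlonglongrightarrow> \<alpha>"
      unfolding assms(5) by (rule palm_estimates_limit[OF est k cont r assms(4) lim small' F])
  next
    assume small: "a \<in> o(\<lambda>n. real n powr (1 / 3))" and X: "iid_uniform M' X"
    have const: "(\<lambda>n. s0 / real n powr (1 / 3)) \<longlonglongrightarrow> 0"
      by real_asymp
    have "(\<lambda>n. a n / real n powr (1 / 3) + s0 / real n powr (1 / 3)) \<longlonglongrightarrow> 0 + 0"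
      by (intro tendsto_add smalloD_tendsto[OF small] const)
    then have x: "(\<lambda>n. (a n + s0) / real n powr (1 / 3)) \<longlonglongrightarrow> 0"
      by (simp add: add_divide_distrib)
    have scale: "(\<lambda>n. real n powr (1 / 3) / real n) \<longlonglongrightarrow> 0" "(\<lambda>n. (real n powr (1 / 3)) ^ 2 / real n) \<longlonglongrightarrow> 0"
      by real_asymp+
    have "(\<lambda>n. (a n + s0) / real n powr (1 / 3) * (real n powr (1 / 3) / real n)) \<longlonglongrightarrow> 0 * 0"
      by (intro tendsto_mult x scale)
    moreover have "eventually (\<lambda>n. (a n + s0) / real n powr (1 / 3) * (real n powr (1 / 3) / real n) = (a n + s0) / real n) sequentially"
      using eventually_gt_at_top[of 0] by eventually_elim simp
    ultimately have small': "(\<lambda>n. (a n + s0) / real n) \<longlonglongrightarrow> 0"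
      using Lim_transform_eventually by fastforce
    have "(\<lambda>n. ((a n + s0) / real n powr (1 / 3)) ^ 2 * ((real n powr (1 / 3)) ^ 2 / real n)) \<longlonglongrightarrow> 0 ^ 2 * 0"
      by (intro tendsto_mult tendsto_power x scale)
    moreover have "eventually (\<lambda>n. ((a n + s0) / real n powr (1 / 3)) ^ 2 * ((real n powr (1 / 3)) ^ 2 / real n)
        = (a n + s0) ^ 2 / real n) sequentially"
      using eventually_gt_at_top[of 0] by eventually_elim (simp add: power_divide)
    ultimately have sq: "(\<lambda>n. (a n + s0) ^ 2 / real n) \<longlonglongrightarrow> 0"
      using Lim_transform_eventually by fastforce
    have "(\<lambda>n. binomial_cdf (n - 1) (k - 1) ((a n + s0) / real n) / (a n ^ (k - 1) * exp (- a n)))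
        \<longlonglongrightarrow> exp (- s0) / fact (k - 1)"
      by (rule binomial_cdf_scaling_limit[OF lim(1) refl sq small'])
    moreover have "eventually (\<lambda>n. binomial_cdf (n - 1) (k - 1) ((a n + s0) / real n) / (a n ^ (k - 1) * exp (- a n))
        = real n * binomial_cdf (n - 1) (k - 1) ((a n + s0) / real n) / b n) sequentially"
      using eventually_gt_at_top[of 0] by eventually_elim (simp add: assms(4))
    ultimately have F: "(\<lambda>n. real n * binomial_cdf (n - 1) (k - 1) ((a n + s0) / real n) / b n)
        \<longlonglongrightarrow> exp (- s0) / fact (k - 1)"
      by (rule Lim_transform_eventually)
    have est: "eventually (\<lambda>n. palm_estimates M' (binomial_process X n) (real n) (exp (2 * real k + 2))
        (\<Sum>i\<le>k - 1. real ((n - 1) choose i) * real i) k (binomial_cdf (n - 1) (k - 1))) sequentially"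
      by (intro always_eventually allI binomial_process_estimates X k)
    show "(\<lambda>n. measure M' {w \<in> space M'. low_degree_count k (r n) (binomial_process X n w) \<ge> 1} / b n) \<longlonglongrightarrow> \<alpha>"
      unfolding assms(5)
      by (rule palm_estimates_limit[OF est k isCont_binomial_cdf r assms(4) lim small' F])
  }
qed

end
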